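(* Under the low-edge, fixed-active-support assumptions described in the context, set $\alpha_j:=C_j^{-1}a_j$ and $$\Lambda_j:=\sum_{k\ne j}a_k^\top C_k^{-1}a_k\qquad(1\le j\le m).$$ Then, for each active block $j$, as $\varepsilon\to0$, $$x_j^{\mathrm{sim}}(\varepsilon)=x_j^{\mathrm{ind}}(\varepsilon)-\Lambda_j\alpha_j\varepsilon^3+O(\varepsilon^4)=\bigl(1-\Lambda_j\varepsilon^2\bigr)x_j^{\mathrm{ind}}(\varepsilon)+O(\varepsilon^4).$$ Consequently, the simultaneous singles-only optimizer agrees with the isolated eventwise Kelly optimizer through second order (i.e. $x_j^{\mathrm{sim}}(\varepsilon)-x_j^{\mathrm{ind}}(\varepsilon)=O(\varepsilon^3)$), and the first portfolio interaction is a cubic, event-specific, blockwise scalar shrinkage.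
   Context: There are $m\ge1$ event blocks. For each small edge parameter $\varepsilon>0$ and each $j=1,\dots,m$, $Z_j^{(\varepsilon)}$ is a random vector in $\mathbb{R}^{d_j}$ (the excess-return vector of block $j$ restricted to its active outcomes; its law may depend on $\varepsilon$), and a stake vector on block $j$ is a vector of nonnegative stakes $x_j\in\mathbb{R}^{d_j}$ on the active outcomes. Standing low-edge assumptions: (i) for each $\varepsilon$ the blocks $Z_1^{(\varepsilon)},\dots,Z_m^{(\varepsilon)}$ are independent; (ii) the $Z_j^{(\varepsilon)}$ are uniformly bounded (by a constant not depending on $\varepsilon$); (iii) as $\varepsilon\to0$, $\mathbb{E}[Z_j^{(\varepsilon)}]=a_j\varepsilon+O(\varepsilon^2)$ and $\mathbb{E}[Z_j^{(\varepsilon)}Z_j^{(\varepsilon)\top}]=C_j+O(\varepsilon)$, with fixed $a_j\in\mathbb{R}^{d_j}$ and fixed positive definite $C_j$; (iv) the active support is fixed for all sufficiently small $\varepsilon$: the maximizers below have all coordinates strictly positive, so that the nonnegativity constraints do not bind. Objectives (with $\log t=-\infty$ for $t\le0$): $$\mathcal{G}^{\mathrm{ind}}_{j,\varepsilon}(y):=\mathbb{E}\bigl[\log(1+y^\top Z_j^{(\varepsilon)})\bigr],\qquad \mathcal{G}^{\mathrm{sing}}_{\varepsilon}(x_1,\dots,x_m):=\mathbb{E}\Bigl[\log\Bigl(1+\sum_{j=1}^m x_j^\top Z_j^{(\varepsilon)}\Bigr)\Bigr].$$ $x_j^{\mathrm{ind}}(\varepsilon)$ denotes the maximizer of $\mathcal{G}^{\mathrm{ind}}_{j,\varepsilon}$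 (isolated maximizer), and $x^{\mathrm{sim}}(\varepsilon)=(x_1^{\mathrm{sim}}(\varepsilon),\dots,x_m^{\mathrm{sim}}(\varepsilon))$ the maximizer of $\mathcal{G}^{\mathrm{sing}}_\varepsilon$ (singles-only simultaneous maximizer). *)

theory Defs
  imports
    "HOL-Probability.Probability"
    "HOL-Library.Landau_Symbols"
    "Jordan_Normal_Form.Gauss_Jordan_Elimination"
begin

text \<open>The blocks live in \<open>\<real>\<^sup>d\<close> with \<open>d\<close> depending on the block, so vectors and matrices are the
  dimension-carrying ones of \<open>Jordan_Normal_Form\<close>.  They share their notation (and the name
  \<open>vec\<close>) with \<open>HOL-Analysis\<close>, which is switched off here.\<close>

unbundle no inner_syntax
unbundle no vec_syntax
hide_const (open) Finite_Cartesian_Product.vec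

text \<open>The Borel structure on \<open>\<real>\<^sup>d\<close>, transported from the product \<open>\<sigma>\<close>-algebra on
  \<open>{..<d} \<rightarrow> \<real>\<close> along the coordinate map.\<close>

definition borel_vec :: "nat \<Rightarrow> real vec measure" where
  "borel_vec d = vimage_algebra (carrier_vec d) (\<lambda>v. \<lambda>i\<in>{..<d}. v $ i)
     (\<Pi>\<^sub>M i\<in>{..<d}. (borel :: real measure))"

lemma space_borel_vec [simp]: "space (borel_vec d) = carrier_vec d"
  by (simp add: borel_vec_def)

lemma measurable_borel_vec_iff:
  "X \<in> M \<rightarrow>\<^sub>M borel_vec d \<longleftrightarrow>
     X \<in> space M \<rightarrow> carrier_vec d \<and> (\<forall>i<d. (\<lambda>\<omega>. X \<omega> $ i) \<in> borel_measurable M)"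
proof
  assume X: "X \<in> M \<rightarrow>\<^sub>M borel_vec d"
  have "(\<lambda>v. \<lambda>i\<in>{..<d}. v $ i) \<in> borel_vec d \<rightarrow>\<^sub>M (\<Pi>\<^sub>M i\<in>{..<d}. (borel :: real measure))"
    unfolding borel_vec_def by (rule measurable_vimage_algebra1) (auto simp: space_PiM)
  from measurable_compose[OF X this]
  have r: "(\<lambda>\<omega>. \<lambda>i\<in>{..<d}. X \<omega> $ i) \<in> M \<rightarrow>\<^sub>M (\<Pi>\<^sub>M i\<in>{..<d}. borel)" .
  have "(\<lambda>\<omega>. X \<omega> $ i) \<in> borel_measurable M" if "i < d" for i
    using measurable_compose[OF r measurable_component_singleton, of i] that by simp
  then show "X \<in> space M \<rightarrow> carrier_vec d \<and> (\<forall>i<d. (\<lambda>\<omega>. X \<omega> $ i) \<in> borel_measurable M)"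
    using measurable_space[OF X] by auto
next
  assume X: "X \<in> space M \<rightarrow> carrier_vec d \<and> (\<forall>i<d. (\<lambda>\<omega>. X \<omega> $ i) \<in> borel_measurable M)"
  show "X \<in> M \<rightarrow>\<^sub>M borel_vec d"
    unfolding borel_vec_def
    by (rule measurable_vimage_algebra2) (use X in \<open>auto intro!: measurable_restrict\<close>)
qed

definition mean_vec :: "'w measure \<Rightarrow> nat \<Rightarrow> ('w \<Rightarrow> real vec) \<Rightarrow> real vec" where
  "mean_vec M d X = vec d (\<lambda>i. \<integral>\<omega>. X \<omega> $ i \<partial>M)"

definition second_moment_mat :: "'w measure \<Rightarrow> nat \<Rightarrow> ('w \<Rightarrow> real vec) \<Rightarrow> real mat" where
  "second_moment_mat M d X = mat d d (\<lambda>(i, l). \<integral>\<omega>. X \<omega> $ i * X \<omega> $ l \<partial>M)"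

definition pos_def_mat :: "nat \<Rightarrow> real mat \<Rightarrow> bool" where
  "pos_def_mat d C \<longleftrightarrow> C \<in> carrier_mat d d \<and> transpose_mat C = C \<and>
     (\<forall>v\<in>carrier_vec d. v \<noteq> 0\<^sub>v d \<longrightarrow> v \<bullet> (C *\<^sub>v v) > 0)"

text \<open>\<open>mat_inverse\<close> returns an option; it is \<open>Some\<close> of the inverse for every invertible square
  matrix, in particular for every positive definite one.\<close>

abbreviation inv_mat :: "real mat \<Rightarrow> real mat" where
  "inv_mat C \<equiv> the (mat_inverse C)"

definition stakes :: "nat \<Rightarrow> real vec set" where
  "stakes d = {y \<in> carrier_vec d. \<forall>i<d. 0 \<le> y $ i}"

definition ext_ln :: "real \<Rightarrow> ereal" where
  "ext_ln t = (if t \<le> 0 then -\<infinity> else ereal (ln t))"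

text \<open>Extended-real expectation: the Bochner integral would assign 0 to a log-return
  that is not integrable, whereas here the value has to be \<open>-\<infinity>\<close>.  Returns are bounded, so the
  first integral below is always finite and no \<open>\<infinity> - \<infinity>\<close> arises.\<close>

definition ext_expectation :: "'w measure \<Rightarrow> ('w \<Rightarrow> ereal) \<Rightarrow> ereal" where
  "ext_expectation M f =
     enn2ereal (\<integral>\<^sup>+\<omega>. e2ennreal (f \<omega>) \<partial>M) - enn2ereal (\<integral>\<^sup>+\<omega>. e2ennreal (- f \<omega>) \<partial>M)"

definition growth_ind :: "'w measure \<Rightarrow> ('w \<Rightarrow> real vec) \<Rightarrow> real vec \<Rightarrow> ereal" where
  "growth_ind M X y = ext_expectation M (\<lambda>\<omega>. ext_ln (1 + y \<bullet> X \<omega>))"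

definition growth_sing ::
    "'w measure \<Rightarrow> nat \<Rightarrow> (nat \<Rightarrow> 'w \<Rightarrow> real vec) \<Rightarrow> (nat \<Rightarrow> real vec) \<Rightarrow> ereal" where
  "growth_sing M m X x = ext_expectation M (\<lambda>\<omega>. ext_ln (1 + (\<Sum>j\<in>{1..m}. x j \<bullet> X j \<omega>)))"

definition is_ind_maximizer :: "'w measure \<Rightarrow> nat \<Rightarrow> ('w \<Rightarrow> real vec) \<Rightarrow> real vec \<Rightarrow> bool" where
  "is_ind_maximizer M d X y \<longleftrightarrow> is_arg_max (growth_ind M X) (\<lambda>y. y \<in> stakes d) y"

definition is_sim_maximizer ::
    "'w measure \<Rightarrow> nat \<Rightarrow> (nat \<Rightarrow> nat) \<Rightarrow> (nat \<Rightarrow> 'w \<Rightarrow> real vec) \<Rightarrow> (nat \<Rightarrow> real vec) \<Rightarrow> bool" where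
  "is_sim_maximizer M m d X x \<longleftrightarrow>
     is_arg_max (growth_sing M m X) (\<lambda>x. \<forall>j\<in>{1..m}. x j \<in> stakes (d j)) x"

definition alpha :: "(nat \<Rightarrow> real mat) \<Rightarrow> (nat \<Rightarrow> real vec) \<Rightarrow> nat \<Rightarrow> real vec" where
  "alpha C a j = inv_mat (C j) *\<^sub>v a j"

definition Lambda :: "nat \<Rightarrow> (nat \<Rightarrow> real mat) \<Rightarrow> (nat \<Rightarrow> real vec) \<Rightarrow> nat \<Rightarrow> real" where
  "Lambda m C a j = (\<Sum>k\<in>{1..m} - {j}. a k \<bullet> (inv_mat (C k) *\<^sub>v a k))"

end

theory Submission
  imports Defs "Jordan_Normal_Form.Determinant"
begin

text \<open>Write \<open>S = u + w\<close> for the joint portfolio return, with \<open>u = x\<^sub>j \<bullet> Z\<^sub>j\<close> the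
contribution of block \<open>j\<close> and \<open>w\<close> that of the other blocks, which is independent of \<open>u\<close>.
The returns are bounded and nearly centred while their second moments stay nondegenerate, so
\<open>ln (1 + t) \<le> t - t\<^sup>2 / (2 * (1 + T))\<close> for \<open>t \<le> T\<close> forces every optimum to be of size
\<open>O(\<epsilon>)\<close> (\<open>portfolio_localized\<close>, \<open>optimum_bigO\<close>).  Then \<open>1 + S\<close> is bounded away from \<open>0\<close>, an
optimum with positive coordinates satisfies \<open>E[Z / (1 + S)] = 0\<close> (\<open>first_order_condition\<close>), and
expanding this condition once gives \<open>x\<^sub>j = \<epsilon> \<alpha>\<^sub>j + O(\<epsilon>\<^sup>2)\<close> for the joint and the isolated problem alike
(\<open>optimum_first_approx\<close>).

Put \<open>v = 1 / (1 + u)\<close>.  Expanding \<open>1 / (1 + u + w)\<close> in powers of \<open>w\<close> and using independence turns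
the joint first-order condition of block \<open>j\<close> into
\<open>0 = E[Z\<^sub>j v] - E[w] E[Z\<^sub>j v\<^sup>2] + E[w\<^sup>2] E[Z\<^sub>j v\<^sup>3] + O(\<epsilon>\<^sup>4)\<close>.
Both \<open>E[w]\<close> and \<open>E[w\<^sup>2]\<close> equal \<open>\<Lambda>\<^sub>j \<epsilon>\<^sup>2 + O(\<epsilon>\<^sup>3)\<close>, since \<open>\<Sum>\<^sub>k a\<^sub>k \<bullet> \<alpha>\<^sub>k\<close> and
\<open>\<Sum>\<^sub>k \<alpha>\<^sub>k \<bullet> C\<^sub>k \<alpha>\<^sub>k\<close> agree; and \<open>E[Z\<^sub>j v\<^sup>n] = (1 - n) \<epsilon> a\<^sub>j + O(\<epsilon>\<^sup>2)\<close>, because the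
mean and \<open>E[Z\<^sub>j u]\<close> coincide to first order.  The two correction terms contribute \<open>+1\<close> and \<open>-2\<close>
times \<open>\<Lambda>\<^sub>j \<epsilon>\<^sup>3 a\<^sub>j\<close>, hence the gradient of the isolated objective at the joint stakes is
\<open>E[Z\<^sub>j v] = \<Lambda>\<^sub>j \<epsilon>\<^sup>3 a\<^sub>j + O(\<epsilon>\<^sup>4)\<close> (\<open>block_gradient_at_joint\<close>).  At the isolated stakes
that gradient vanishes, and between the two points it changes by
\<open>- (C\<^sub>j + O(\<epsilon>)) (x_sim - x_ind)\<close>.  Solving for the difference gives \<open>- \<Lambda>\<^sub>j \<epsilon>\<^sup>3 \<alpha>\<^sub>j + O(\<epsilon>\<^sup>4)\<close>
(\<open>cubic_shrinkage\<close>).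

The analysis is carried out for scalar returns indexed by a finite set of coordinates, so that the
joint and the isolated problem are instances of the same statement.  For
the blocks themselves, a coordinate is a pair of a block and a position in it.\<close>

section \<open>Positive definite forms\<close>

text \<open>With row \<open>P p\<close> of the inverse, evaluating the form at \<open>y - t * P p\<close> gives
\<open>F y y - 2 * t * y p + t\<^sup>2 * P p p\<close>, which is nonnegative for every \<open>t\<close>; a suitable \<open>t\<close> bounds the
single coordinate \<open>y p\<close>.  This yields coercivity with an explicit constant.\<close>

lemma finite_quadratic_form_coercive:
  fixes Q P :: "'i \<Rightarrow> 'i \<Rightarrow> real" and I :: "'i set"
  assumes fin: "finite I"
    and sym: "\<And>p q. p \<in> I \<Longrightarrow> q \<in> I \<Longrightarrow> Q p q = Q q p"
    and psd: "\<And>y. 0 \<le> (\<Sum>p\<in>I. \<Sum>q\<in>I. y p * Q p q * y q)"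
    and inv: "\<And>p r. p \<in> I \<Longrightarrow> r \<in> I \<Longrightarrow> (\<Sum>q\<in>I. P p q * Q q r) = (if p = r then 1 else 0)"
  shows "\<exists>\<kappa>>0. \<forall>y. (\<Sum>p\<in>I. \<bar>y p\<bar>)\<^sup>2 \<le> \<kappa> * (\<Sum>p\<in>I. \<Sum>q\<in>I. y p * Q p q * y q)"
proof -
  define F where "F y z = (\<Sum>p\<in>I. \<Sum>q\<in>I. y p * Q p q * z q)" for y z :: "'i \<Rightarrow> real"
  have F_swap: "F y z = F z y" for y z
  proof -
    have "F y z = (\<Sum>q\<in>I. \<Sum>p\<in>I. y p * Q p q * z q)"
      unfolding F_def by (rule sum.swap)
    also have "\<dots> = F z y"
      unfolding F_def by (intro sum.cong refl) (simp add: sym mult_ac)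
    finally show ?thesis .
  qed
  have row: "F (P p) y = y p" if p: "p \<in> I" for p y
  proof -
    have "F (P p) y = (\<Sum>r\<in>I. \<Sum>q\<in>I. P p q * Q q r * y r)"
      unfolding F_def by (rule sum.swap)
    also have "\<dots> = (\<Sum>r\<in>I. if p = r then y r else 0)"
      by (intro sum.cong refl) (simp add: inv[OF p] flip: sum_distrib_right)
    also have "\<dots> = y p"
      using fin p by simp
    finally show ?thesis .
  qed
  have coord: "(y p)\<^sup>2 \<le> (\<bar>P p p\<bar> + 1) * F y y" if p: "p \<in> I" for p y
  proof -
    \<comment> \<open>The choice \<open>\<tau> = 1 / P p p\<close> would be optimal; this one is positive whatever the sign of \<open>P p p\<close>.\<close>
    define \<tau> where "\<tau> = 1 / (\<bar>P p p\<bar> + 1)"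
    define t where "t = \<tau> * y p"
    have "0 \<le> F (\<lambda>q. y q - t * P p q) (\<lambda>q. y q - t * P p q)"
      unfolding F_def by (rule psd)
    also have "\<dots> = F y y - t * F y (P p) - t * F (P p) y + t\<^sup>2 * F (P p) (P p)"
      unfolding F_def
      by (simp add: sum_subtractf sum.distrib sum_distrib_left algebra_simps power2_eq_square)
    also have "\<dots> = F y y - 2 * t * y p + t\<^sup>2 * P p p"
      by (simp add: row[OF p] F_swap[of y "P p"])
    finally have 1: "2 * t * y p \<le> F y y + t\<^sup>2 * P p p" by simp
    \<comment> \<open>The quadratic term \<open>t\<^sup>2 * P p p\<close> amounts to at most half of the linear one.\<close>
    have \<tau>: "\<tau> > 0" "\<tau> * P p p \<le> 1"
      unfolding \<tau>_def by (auto simp: field_simps)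
    have "t\<^sup>2 * P p p = (\<tau> * P p p) * (\<tau> * (y p)\<^sup>2)"
      by (simp add: t_def power2_eq_square)
    also have "\<dots> \<le> 1 * (\<tau> * (y p)\<^sup>2)"
      using \<tau> by (intro mult_right_mono) auto
    finally have "2 * \<tau> * (y p)\<^sup>2 \<le> F y y + \<tau> * (y p)\<^sup>2"
      using 1 by (simp add: t_def power2_eq_square)
    then have "\<tau> * (y p)\<^sup>2 \<le> F y y" by simp
    then show ?thesis
      unfolding \<tau>_def by (simp add: field_simps add_pos_nonneg)
  qed
  define \<kappa> where "\<kappa> = real (card I) * (\<Sum>p\<in>I. \<bar>P p p\<bar> + 1) + 1"
  have "\<kappa> > 0"
    unfolding \<kappa>_def by (intro add_nonneg_pos mult_nonneg_nonneg sum_nonneg) auto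
  moreover have "(\<Sum>p\<in>I. \<bar>y p\<bar>)\<^sup>2 \<le> \<kappa> * F y y" for y
  proof -
    have "(\<Sum>p\<in>I. \<bar>y p\<bar>)\<^sup>2 \<le> (\<Sum>p\<in>I. (1::real)\<^sup>2) * (\<Sum>p\<in>I. \<bar>y p\<bar>\<^sup>2)"
      using Cauchy_Schwarz_ineq_sum[of "\<lambda>_. 1" "\<lambda>p. \<bar>y p\<bar>" I] by simp
    also have "\<dots> \<le> real (card I) * (\<Sum>p\<in>I. (\<bar>P p p\<bar> + 1) * F y y)"
      using coord by (auto intro!: mult_left_mono sum_mono)
    also have "\<dots> = (\<kappa> - 1) * F y y"
      by (simp add: \<kappa>_def sum_distrib_right)
    also have "\<dots> \<le> \<kappa> * F y y"
      using psd[of y] unfolding F_def[symmetric] by (intro mult_right_mono) auto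
    finally show ?thesis .
  qed
  ultimately show ?thesis
    unfolding F_def by blast
qed

lemma pos_def_mat_inverse:
  assumes "pos_def_mat d C"
  shows "inv_mat C \<in> carrier_mat d d" "C * inv_mat C = 1\<^sub>m d" "inv_mat C * C = 1\<^sub>m d"
proof -
  have C: "C \<in> carrier_mat d d"
    and pos: "\<And>v. v \<in> carrier_vec d \<Longrightarrow> v \<noteq> 0\<^sub>v d \<Longrightarrow> v \<bullet> (C *\<^sub>v v) > 0"
    using assms by (auto simp: pos_def_mat_def)
  have "C *\<^sub>v v \<noteq> 0\<^sub>v d" if "v \<in> carrier_vec d" "v \<noteq> 0\<^sub>v d" for v
    using pos[OF that] that by auto
  then have "Determinant.det C \<noteq> 0"
    using det_0_iff_vec_prod_zero[OF C] by blast
  then have "C \<in> Units (ring_mat TYPE(real) d ())"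
    by (rule det_non_zero_imp_unit[OF C])
  then obtain D where "mat_inverse C = Some D"
    using mat_inverse(1)[OF C, where b = "()"] by (cases "mat_inverse C") auto
  with mat_inverse(2)[OF C this]
  show "inv_mat C \<in> carrier_mat d d" "C * inv_mat C = 1\<^sub>m d" "inv_mat C * C = 1\<^sub>m d" by auto
qed

lemma pos_def_mat_sym:
  assumes "pos_def_mat d C" "i < d" "l < d"
  shows "C $$ (i, l) = C $$ (l, i)"
proof -
  have C: "C \<in> carrier_mat d d" and T: "transpose_mat C = C"
    using assms by (auto simp: pos_def_mat_def)
  have "C $$ (i, l) = transpose_mat C $$ (i, l)" using T by simp
  also have "\<dots> = C $$ (l, i)" using C assms by simp
  finally show ?thesis .
qed

lemma pos_def_mat_form_nonneg:
  assumes "pos_def_mat d C"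
  shows "0 \<le> (\<Sum>i<d. \<Sum>l<d. y i * C $$ (i, l) * y l)"
proof -
  have C: "C \<in> carrier_mat d d"
    and pos: "\<And>v. v \<in> carrier_vec d \<Longrightarrow> v \<noteq> 0\<^sub>v d \<Longrightarrow> v \<bullet> (C *\<^sub>v v) > 0"
    using assms by (auto simp: pos_def_mat_def)
  define v where "v = vec d y"
  have v: "v \<in> carrier_vec d" by (simp add: v_def)
  have "v \<bullet> (C *\<^sub>v v) \<ge> 0"
  proof (cases "v = 0\<^sub>v d")
    case True then show ?thesis using C by (auto simp: scalar_prod_def)
  qed (use pos[OF v] in auto)
  also have "v \<bullet> (C *\<^sub>v v) = (\<Sum>i<d. \<Sum>l<d. y i * C $$ (i, l) * y l)"
    using C by (simp add: v_def scalar_prod_def lessThan_atLeast0 sum_distrib_left mult_ac)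
  finally show ?thesis .
qed

lemma pos_def_mat_left_inverse_entries:
  assumes "pos_def_mat d C" "i < d" "l < d"
  shows "(\<Sum>k<d. inv_mat C $$ (i, k) * C $$ (k, l)) = (if i = l then 1 else 0)"
proof -
  have C: "C \<in> carrier_mat d d" using assms by (auto simp: pos_def_mat_def)
  note i = pos_def_mat_inverse[OF assms(1)]
  have "(inv_mat C * C) $$ (i, l) = (\<Sum>k<d. inv_mat C $$ (i, k) * C $$ (k, l))"
    using C i(1) assms(2,3) by (simp add: scalar_prod_def lessThan_atLeast0)
  then show ?thesis using i(3) assms(2,3) by simp
qed

lemma pos_def_mat_mult_inverse_vec:
  assumes "pos_def_mat d C" "b \<in> carrier_vec d" "i < d"
  shows "(\<Sum>l<d. C $$ (i, l) * (inv_mat C *\<^sub>v b) $ l) = b $ i"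
proof -
  have C: "C \<in> carrier_mat d d" using assms by (auto simp: pos_def_mat_def)
  note i = pos_def_mat_inverse[OF assms(1)]
  have "C *\<^sub>v (inv_mat C *\<^sub>v b) = (C * inv_mat C) *\<^sub>v b"
    using C i(1) assms(2) by simp
  then have "C *\<^sub>v (inv_mat C *\<^sub>v b) = b" using i assms(2) by simp
  then have "b $ i = (C *\<^sub>v (inv_mat C *\<^sub>v b)) $ i" by simp
  also have "\<dots> = (\<Sum>l<d. C $$ (i, l) * (inv_mat C *\<^sub>v b) $ l)"
    using C i(1) assms(2,3) by (simp add: scalar_prod_def lessThan_atLeast0)
  finally show ?thesis by simp
qed

section \<open>Expected logarithms\<close>

text \<open>The derivative of the right-hand side minus the left-hand side is
\<open>t * (T - t) / ((1 + t) * (1 + T))\<close>, so that difference attains its minimum on \<open>{-1<..T}\<close> at \<open>0\<close>.  The bound is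
used with \<open>T\<close> proportional to the total stake: it is quadratic for small stakes
and still linear for large ones, which excludes distant optima.\<close>

lemma ln_one_plus_le_quadratic:
  fixes t T :: real
  assumes "-1 < t" "t \<le> T" "0 \<le> T"
  shows "ln (1 + t) \<le> t - t\<^sup>2 / (2 * (1 + T))"
proof -
  define f where "f s = s - s\<^sup>2 / (2 * (1 + T)) - ln (1 + s)" for s :: real
  have der: "(f has_real_derivative s * (T - s) / ((1 + s) * (1 + T))) (at s)" if "-1 < s" for s
    unfolding f_def using that assms(3)
    by (auto intro!: derivative_eq_intros simp: divide_simps) (simp add: algebra_simps)
  have "f 0 \<le> f t"
  proof (cases "0 \<le> t")
    case True
    show ?thesis
    proof (rule DERIV_nonneg_imp_nondecreasing[OF True])
      fix s assume s: "0 \<le> s" "s \<le> t"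
      show "\<exists>y. (f has_real_derivative y) (at s) \<and> 0 \<le> y"
        using der[of s] s assms by (intro exI[of _ "s * (T - s) / ((1 + s) * (1 + T))"]) auto
    qed
  next
    case False
    show ?thesis
    proof (rule DERIV_nonpos_imp_nonincreasing[of t 0])
      fix s assume s: "t \<le> s" "s \<le> 0"
      show "\<exists>y. (f has_real_derivative y) (at s) \<and> y \<le> 0"
        using der[of s] s assms
        by (intro exI[of _ "s * (T - s) / ((1 + s) * (1 + T))"])
           (auto intro!: divide_nonpos_pos mult_nonpos_nonneg mult_pos_pos)
    qed (use False in auto)
  qed
  then show ?thesis by (simp add: f_def)
qed

context prob_space
begin

lemma ext_expectation_ext_ln_eq:
  assumes pos: "AE \<omega> in M. 0 < f \<omega>" and int: "integrable M (\<lambda>\<omega>. ln (f \<omega>))"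
  shows "ext_expectation M (\<lambda>\<omega>. ext_ln (f \<omega>)) = ereal (\<integral>\<omega>. ln (f \<omega>) \<partial>M)"
proof -
  have 1: "(\<integral>\<^sup>+\<omega>. e2ennreal (ext_ln (f \<omega>)) \<partial>M) = (\<integral>\<^sup>+\<omega>. ennreal (ln (f \<omega>)) \<partial>M)"
    using pos by (intro nn_integral_cong_AE) (auto simp: ext_ln_def)
  have 2: "(\<integral>\<^sup>+\<omega>. e2ennreal (- ext_ln (f \<omega>)) \<partial>M) = (\<integral>\<^sup>+\<omega>. ennreal (- ln (f \<omega>)) \<partial>M)"
    using pos by (intro nn_integral_cong_AE) (auto simp: ext_ln_def)
  have fin: "(\<integral>\<^sup>+\<omega>. ennreal (ln (f \<omega>)) \<partial>M) \<noteq> \<infinity>" "(\<integral>\<^sup>+\<omega>. ennreal (- ln (f \<omega>)) \<partial>M) \<noteq> \<infinity>"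
    using int by (auto simp: real_integrable_def)
  have *: "enn2ereal x = ereal (enn2real x)" if "x \<noteq> \<infinity>" for x
    using that by (cases x) auto
  show ?thesis
    unfolding ext_expectation_def 1 2 real_lebesgue_integral_def[OF int] fin[THEN *] by simp
qed

text \<open>The upper bound on \<open>f\<close> makes the positive part of the logarithm integrable, so a value above
\<open>-\<infinity>\<close> forces the negative part to be integrable too.  The optimum beats the zero portfolio, hence
this brings its growth rate into the realm of the ordinary integral.\<close>

lemma ext_expectation_ext_ln_nonnegD:
  assumes [measurable]: "f \<in> borel_measurable M"
    and bd: "AE \<omega> in M. f \<omega> \<le> T"
    and nonneg: "0 \<le> ext_expectation M (\<lambda>\<omega>. ext_ln (f \<omega>))"
  shows "AE \<omega> in M. 0 < f \<omega>" "integrable M (\<lambda>\<omega>. ln (f \<omega>))"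
    "0 \<le> (\<integral>\<omega>. ln (f \<omega>) \<partial>M)"
proof -
  have [measurable]: "(\<lambda>\<omega>. ext_ln (f \<omega>)) \<in> borel_measurable M"
    unfolding ext_ln_def by measurable
  have "(\<integral>\<^sup>+\<omega>. e2ennreal (ext_ln (f \<omega>)) \<partial>M) \<le> (\<integral>\<^sup>+\<omega>. ennreal \<bar>T\<bar> \<partial>M)"
  proof (rule nn_integral_mono_AE, use bd in eventually_elim)
    case (elim \<omega>)
    show ?case
    proof (cases "f \<omega> \<le> 0")
      case True then show ?thesis by (simp add: ext_ln_def e2ennreal_neg)
    next
      case False
      then have "ln (f \<omega>) \<le> \<bar>T\<bar>" using ln_le_minus_one[of "f \<omega>"] elim by auto
      then show ?thesis using False by (simp add: ext_ln_def ennreal_leI)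
    qed
  qed
  also have "\<dots> < \<infinity>" by (simp add: emeasure_space_1)
  finally have P: "(\<integral>\<^sup>+\<omega>. e2ennreal (ext_ln (f \<omega>)) \<partial>M) \<noteq> \<infinity>" by simp
  have N: "(\<integral>\<^sup>+\<omega>. e2ennreal (- ext_ln (f \<omega>)) \<partial>M) \<noteq> \<infinity>"
  proof
    assume *: "(\<integral>\<^sup>+\<omega>. e2ennreal (- ext_ln (f \<omega>)) \<partial>M) = \<infinity>"
    show False
      using nonneg P unfolding ext_expectation_def *
      by (cases "\<integral>\<^sup>+\<omega>. e2ennreal (ext_ln (f \<omega>)) \<partial>M" ) auto
  qed
  have "AE \<omega> in M. e2ennreal (- ext_ln (f \<omega>)) \<noteq> \<infinity>"
    by (rule nn_integral_PInf_AE[OF _ N]) measurable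
  then show pos: "AE \<omega> in M. 0 < f \<omega>"
    by eventually_elim (auto simp: ext_ln_def split: if_splits)
  have 1: "(\<integral>\<^sup>+\<omega>. e2ennreal (ext_ln (f \<omega>)) \<partial>M) = (\<integral>\<^sup>+\<omega>. ennreal (ln (f \<omega>)) \<partial>M)"
    using pos by (intro nn_integral_cong_AE) (auto simp: ext_ln_def)
  have 2: "(\<integral>\<^sup>+\<omega>. e2ennreal (- ext_ln (f \<omega>)) \<partial>M) = (\<integral>\<^sup>+\<omega>. ennreal (- ln (f \<omega>)) \<partial>M)"
    using pos by (intro nn_integral_cong_AE) (auto simp: ext_ln_def)
  show int: "integrable M (\<lambda>\<omega>. ln (f \<omega>))"
    using P N unfolding 1 2 by (simp add: real_integrable_def)
  show "0 \<le> (\<integral>\<omega>. ln (f \<omega>) \<partial>M)"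
    using nonneg unfolding ext_expectation_ext_ln_eq[OF pos int] by simp
qed

lemma ext_expectation_ext_ln_one [simp]: "ext_expectation M (\<lambda>\<omega>. ext_ln 1) = 0"
  using ext_expectation_ext_ln_eq[of "\<lambda>_. 1"] by simp

end

section \<open>Optimal portfolios under a fixed law\<close>

context prob_space
begin

lemma integrable_AE_bounded:
  fixes f :: "'a \<Rightarrow> real"
  assumes "f \<in> borel_measurable M" "AE \<omega> in M. \<bar>f \<omega>\<bar> \<le> c"
  shows "integrable M f"
  using assms by (intro integrable_const_bound[of _ c]) auto

lemma AE_abs_portfolio_le:
  fixes W :: "'i \<Rightarrow> 'a \<Rightarrow> real"
  assumes fin: "finite I" and bd: "\<And>p. p \<in> I \<Longrightarrow> AE \<omega> in M. \<bar>W p \<omega>\<bar> \<le> B"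
  shows "AE \<omega> in M. \<bar>\<Sum>p\<in>I. x p * W p \<omega>\<bar> \<le> B * (\<Sum>p\<in>I. \<bar>x p\<bar>)"
proof -
  have "AE \<omega> in M. \<forall>p\<in>I. \<bar>W p \<omega>\<bar> \<le> B"
    using fin bd by (intro AE_finite_allI) auto
  then show ?thesis
  proof eventually_elim
    case (elim \<omega>)
    have "\<bar>\<Sum>p\<in>I. x p * W p \<omega>\<bar> \<le> (\<Sum>p\<in>I. \<bar>x p\<bar> * B)"
      using elim by (intro sum_abs[THEN order_trans] sum_mono) (auto simp: abs_mult intro!: mult_left_mono)
    then show ?case by (simp add: sum_distrib_left mult.commute)
  qed
qed

text \<open>Let \<open>R\<close> be the total stake.  The return is at most \<open>B * R\<close>, its mean is at most \<open>\<eta> * R\<close> and its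
second moment at least \<open>\<mu> * R\<^sup>2\<close>, so the quadratic bound on the logarithm gives
\<open>\<mu> * R \<le> 2 * \<eta> * (1 + B * R)\<close>; the smallness of \<open>\<eta>\<close> absorbs the term with \<open>R\<close> on the right.\<close>

lemma portfolio_localized:
  fixes W :: "'i \<Rightarrow> 'a \<Rightarrow> real"
  assumes fin: "finite I"
    and meas: "\<And>p. p \<in> I \<Longrightarrow> W p \<in> borel_measurable M"
    and bd: "\<And>p. p \<in> I \<Longrightarrow> AE \<omega> in M. \<bar>W p \<omega>\<bar> \<le> B" and B: "0 \<le> B"
    and x: "\<And>p. p \<in> I \<Longrightarrow> 0 \<le> x p"
    and nonneg: "0 \<le> ext_expectation M (\<lambda>\<omega>. ext_ln (1 + (\<Sum>p\<in>I. x p * W p \<omega>)))"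
    and drift: "\<And>p. p \<in> I \<Longrightarrow> (\<integral>\<omega>. W p \<omega> \<partial>M) \<le> \<eta>" and \<eta>: "0 \<le> \<eta>"
    and coercive: "\<mu> * (\<Sum>p\<in>I. x p)\<^sup>2 \<le> (\<integral>\<omega>. (\<Sum>p\<in>I. x p * W p \<omega>)\<^sup>2 \<partial>M)" and \<mu>: "0 < \<mu>"
    and small: "4 * \<eta> * B \<le> \<mu>"
  shows "(\<Sum>p\<in>I. x p) \<le> 4 * \<eta> / \<mu>"
proof -
  define R where "R = (\<Sum>p\<in>I. x p)"
  define S where "S \<omega> = (\<Sum>p\<in>I. x p * W p \<omega>)" for \<omega>
  have R: "0 \<le> R" unfolding R_def using x by (intro sum_nonneg) auto
  have absR: "(\<Sum>p\<in>I. \<bar>x p\<bar>) = R" unfolding R_def using x by (intro sum.cong) auto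
  have [measurable]: "S \<in> borel_measurable M"
    unfolding S_def[abs_def] using meas by (intro borel_measurable_sum borel_measurable_times) auto
  have Sbd: "AE \<omega> in M. \<bar>S \<omega>\<bar> \<le> B * R"
    using AE_abs_portfolio_le[OF fin bd, where x = x] unfolding S_def absR by simp
  have T: "0 \<le> B * R" using B R by simp
  have Sle: "AE \<omega> in M. 1 + S \<omega> \<le> 1 + B * R"
    using Sbd by eventually_elim auto
  note log = ext_expectation_ext_ln_nonnegD[OF _ Sle nonneg[folded S_def], simplified]
  have pos: "AE \<omega> in M. 0 < 1 + S \<omega>" using log(1) by simp
  have intS: "integrable M S" using Sbd by (rule integrable_AE_bounded[rotated]) simp
  have intS2: "integrable M (\<lambda>\<omega>. (S \<omega>)\<^sup>2)"
  proof (rule integrable_AE_bounded)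
    show "AE \<omega> in M. \<bar>(S \<omega>)\<^sup>2\<bar> \<le> (B * R)\<^sup>2"
      using Sbd by eventually_elim (use T in \<open>auto intro!: abs_le_square_iff[THEN iffD1]\<close>)
  qed simp
  have "0 \<le> (\<integral>\<omega>. ln (1 + S \<omega>) \<partial>M)" using log(3) by simp
  also have "\<dots> \<le> (\<integral>\<omega>. S \<omega> - (S \<omega>)\<^sup>2 / (2 * (1 + B * R)) \<partial>M)"
  proof (rule integral_mono_AE)
    show "integrable M (\<lambda>\<omega>. ln (1 + S \<omega>))" using log(2) by simp
    show "integrable M (\<lambda>\<omega>. S \<omega> - (S \<omega>)\<^sup>2 / (2 * (1 + B * R)))" using intS intS2 by simp
    show "AE \<omega> in M. ln (1 + S \<omega>) \<le> S \<omega> - (S \<omega>)\<^sup>2 / (2 * (1 + B * R))"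
      using pos Sbd by eventually_elim (intro ln_one_plus_le_quadratic, use T in auto)
  qed
  also have "\<dots> = (\<integral>\<omega>. S \<omega> \<partial>M) - (\<integral>\<omega>. (S \<omega>)\<^sup>2 \<partial>M) / (2 * (1 + B * R))"
    using intS intS2 by simp
  also have "(\<integral>\<omega>. S \<omega> \<partial>M) = (\<Sum>p\<in>I. x p * (\<integral>\<omega>. W p \<omega> \<partial>M))"
    unfolding S_def
    by (subst Bochner_Integration.integral_sum)
       (auto intro!: integrable_mult_right integrable_AE_bounded meas bd)
  also have "\<dots> \<le> (\<Sum>p\<in>I. x p * \<eta>)"
    using x drift by (intro sum_mono mult_left_mono) auto
  also have "\<dots> = R * \<eta>" by (simp add: R_def sum_distrib_right)
  finally have "(\<integral>\<omega>. (S \<omega>)\<^sup>2 \<partial>M) / (2 * (1 + B * R)) \<le> R * \<eta>" by simp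
  then have "(\<integral>\<omega>. (S \<omega>)\<^sup>2 \<partial>M) \<le> R * \<eta> * (2 * (1 + B * R))"
    using T by (simp add: divide_le_eq)
  then have "\<mu> * R\<^sup>2 \<le> R * \<eta> * (2 * (1 + B * R))"
    using coercive unfolding S_def R_def by simp
  then have 1: "R * (\<mu> * R) \<le> R * (2 * \<eta> + 2 * \<eta> * B * R)"
    by (simp add: algebra_simps power2_eq_square)
  show ?thesis
  proof (cases "R = 0")
    case True then show ?thesis using \<eta> \<mu> by (simp add: R_def)
  next
    case False
    then have "\<mu> * R \<le> 2 * \<eta> + 2 * \<eta> * B * R" using 1 R by simp
    also have "2 * \<eta> * B * R \<le> \<mu> / 2 * R" using small R by (intro mult_right_mono) auto
    finally have "\<mu> * R \<le> 4 * \<eta>" by simp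
    then show ?thesis using \<mu> by (simp add: R_def[symmetric] field_simps)
  qed
qed

text \<open>Moving the single stake \<open>x p\<close> by a small \<open>s\<close> of either sign is admissible and changes the growth rate by
\<open>s * e + O(s\<^sup>2)\<close> with \<open>e\<close> the claimed integral; as it cannot increase, \<open>e = 0\<close>.\<close>

lemma first_order_condition:
  fixes W :: "'i \<Rightarrow> 'a \<Rightarrow> real"
  assumes fin: "finite I"
    and meas: "\<And>q. q \<in> I \<Longrightarrow> W q \<in> borel_measurable M"
    and bd: "\<And>q. q \<in> I \<Longrightarrow> AE \<omega> in M. \<bar>W q \<omega>\<bar> \<le> B"
    and x: "\<And>q. q \<in> I \<Longrightarrow> 0 \<le> x q"
    and small: "AE \<omega> in M. \<bar>\<Sum>q\<in>I. x q * W q \<omega>\<bar> \<le> 1 / 2"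
    and maxi: "\<And>y. (\<And>q. q \<in> I \<Longrightarrow> 0 \<le> y q) \<Longrightarrow>
      ext_expectation M (\<lambda>\<omega>. ext_ln (1 + (\<Sum>q\<in>I. y q * W q \<omega>)))
        \<le> ext_expectation M (\<lambda>\<omega>. ext_ln (1 + (\<Sum>q\<in>I. x q * W q \<omega>)))"
    and p: "p \<in> I" "0 < x p" and B: "0 < B"
  shows "(\<integral>\<omega>. W p \<omega> / (1 + (\<Sum>q\<in>I. x q * W q \<omega>)) \<partial>M) = 0"
proof -
  define S where "S \<omega> = (\<Sum>q\<in>I. x q * W q \<omega>)" for \<omega>
  define e where "e = (\<integral>\<omega>. W p \<omega> / (1 + S \<omega>) \<partial>M)"
  have [measurable]: "S \<in> borel_measurable M" "W p \<in> borel_measurable M"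
    unfolding S_def[abs_def] using meas p by (auto intro!: borel_measurable_sum borel_measurable_times)
  have Sbd: "AE \<omega> in M. \<bar>S \<omega>\<bar> \<le> 1 / 2" using small by (simp add: S_def)
  have ln_bound: "\<bar>ln (1 + t)\<bar> \<le> 1" if "\<bar>t\<bar> \<le> 1 / 2" for t :: real
  proof -
    have "t\<^sup>2 \<le> (1 / 2)\<^sup>2" using that by (intro abs_le_square_iff[THEN iffD1]) auto
    then show ?thesis
      using abs_ln_one_plus_x_minus_x_bound[OF that] that by (auto simp: abs_if power2_eq_square split: if_splits)
  qed
  have lnS: "integrable M (\<lambda>\<omega>. ln (1 + S \<omega>))"
  proof (rule integrable_AE_bounded)
    show "AE \<omega> in M. \<bar>ln (1 + S \<omega>)\<bar> \<le> 1" using Sbd by eventually_elim (rule ln_bound)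
  qed simp
  have inte: "integrable M (\<lambda>\<omega>. W p \<omega> / (1 + S \<omega>))"
  proof (rule integrable_AE_bounded)
    show "AE \<omega> in M. \<bar>W p \<omega> / (1 + S \<omega>)\<bar> \<le> B / (1 / 2)"
      using Sbd bd[OF p(1)]
    proof eventually_elim
      case (elim \<omega>)
      then show ?case unfolding abs_divide by (intro frac_le) auto
    qed
  qed simp
  have step: "s * e \<le> 8 * B\<^sup>2 * s\<^sup>2" if s: "\<bar>s\<bar> \<le> x p" "\<bar>s\<bar> * B \<le> 1 / 4" for s
  proof -
    define y where "y = x(p := x p + s)"
    have y: "0 \<le> y q" if "q \<in> I" for q using x that s by (auto simp: y_def)
    have Sy: "(\<Sum>q\<in>I. y q * W q \<omega>) = S \<omega> + s * W p \<omega>" for \<omega>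
    proof -
      have "(\<Sum>q\<in>I. y q * W q \<omega>) = (\<Sum>q\<in>I. x q * W q \<omega> + (if q = p then s * W q \<omega> else 0))"
        by (intro sum.cong) (auto simp: y_def algebra_simps)
      then show ?thesis using fin p by (simp add: sum.distrib S_def)
    qed
    have key: "AE \<omega> in M. 0 < 1 + S \<omega> + s * W p \<omega> \<and>
        \<bar>ln (1 + S \<omega> + s * W p \<omega>) - ln (1 + S \<omega>) - s * (W p \<omega> / (1 + S \<omega>))\<bar> \<le> 8 * B\<^sup>2 * s\<^sup>2"
      using Sbd bd[OF p(1)]
    proof eventually_elim
      case (elim \<omega>)
      define t where "t = s * (W p \<omega> / (1 + S \<omega>))"
      have "\<bar>W p \<omega> / (1 + S \<omega>)\<bar> \<le> B / (1 / 2)"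
        using elim unfolding abs_divide by (intro frac_le) auto
      then have t: "\<bar>t\<bar> \<le> \<bar>s\<bar> * (2 * B)"
        unfolding t_def abs_mult by (intro mult_left_mono) auto
      then have t2: "\<bar>t\<bar> \<le> 1 / 2" using s by simp
      have "t\<^sup>2 \<le> (\<bar>s\<bar> * (2 * B))\<^sup>2"
        using t B by (intro abs_le_square_iff[THEN iffD1]) auto
      then have t3: "2 * t\<^sup>2 \<le> 8 * B\<^sup>2 * s\<^sup>2" by (simp add: power_mult_distrib mult_ac)
      have S1: "0 < 1 + S \<omega>" using elim by auto
      have eq: "1 + S \<omega> + s * W p \<omega> = (1 + S \<omega>) * (1 + t)"
        using S1 by (simp add: t_def field_simps)
      have "ln (1 + S \<omega> + s * W p \<omega>) = ln (1 + S \<omega>) + ln (1 + t)"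
        unfolding eq using S1 t2 by (intro ln_mult_pos) auto
      moreover have "0 < 1 + S \<omega> + s * W p \<omega>"
        unfolding eq using S1 t2 by (intro mult_pos_pos) auto
      ultimately show ?case
        using abs_ln_one_plus_x_minus_x_bound[OF t2] t3 unfolding t_def[symmetric] by auto
    qed
    have pos: "AE \<omega> in M. 0 < 1 + (S \<omega> + s * W p \<omega>)"
      using key by eventually_elim (auto simp: add.assoc)
    have int1: "integrable M (\<lambda>\<omega>. ln (1 + (S \<omega> + s * W p \<omega>)))"
    proof -
      have "integrable M (\<lambda>\<omega>. ln (1 + S \<omega> + s * W p \<omega>) - ln (1 + S \<omega>) - s * (W p \<omega> / (1 + S \<omega>)))"
      proof (rule integrable_AE_bounded)
        show "AE \<omega> in M. \<bar>ln (1 + S \<omega> + s * W p \<omega>) - ln (1 + S \<omega>) - s * (W p \<omega> / (1 + S \<omega>))\<bar> \<le> 8 * B\<^sup>2 * s\<^sup>2"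
          using key by eventually_elim auto
      qed simp
      then have "integrable M (\<lambda>\<omega>. (ln (1 + S \<omega> + s * W p \<omega>) - ln (1 + S \<omega>) - s * (W p \<omega> / (1 + S \<omega>)))
          + (ln (1 + S \<omega>) + s * (W p \<omega> / (1 + S \<omega>))))"
        by (intro Bochner_Integration.integrable_add lnS integrable_mult_right inte) simp
      then show ?thesis by (simp add: add.assoc)
    qed
    have posS: "AE \<omega> in M. 0 < 1 + S \<omega>" using Sbd by eventually_elim auto
    have "(\<integral>\<omega>. ln (1 + S \<omega>) \<partial>M) + s * e - 8 * B\<^sup>2 * s\<^sup>2
        = (\<integral>\<omega>. ln (1 + S \<omega>) + s * (W p \<omega> / (1 + S \<omega>)) - 8 * B\<^sup>2 * s\<^sup>2 \<partial>M)"
      using lnS inte by (simp add: e_def prob_space del: times_divide_eq_right)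
    also have "\<dots> \<le> (\<integral>\<omega>. ln (1 + (S \<omega> + s * W p \<omega>)) \<partial>M)"
    proof (rule integral_mono_AE[OF _ int1])
      show "AE \<omega> in M. ln (1 + S \<omega>) + s * (W p \<omega> / (1 + S \<omega>)) - 8 * B\<^sup>2 * s\<^sup>2
          \<le> ln (1 + (S \<omega> + s * W p \<omega>))"
        using key by eventually_elim (simp add: abs_le_iff add.assoc)
    qed (use lnS inte in \<open>simp del: times_divide_eq_right\<close>)
    also have "\<dots> \<le> (\<integral>\<omega>. ln (1 + S \<omega>) \<partial>M)"
      using maxi[of y, OF y] unfolding Sy S_def[symmetric]
        ext_expectation_ext_ln_eq[OF pos int1] ext_expectation_ext_ln_eq[OF posS lnS] by simp
    finally show ?thesis by simp
  qed
  have "e = 0"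
  proof (rule ccontr)
    assume e: "e \<noteq> 0"
    \<comment> \<open>The first two bounds make both steps \<open>h\<close> and \<open>- h\<close> admissible; the third makes the quadratic error at most half of the linear gain.\<close>
    define h where "h = min (min (x p) (1 / (4 * B))) (\<bar>e\<bar> / (16 * B\<^sup>2))"
    have h: "0 < h" "h \<le> x p" "h \<le> 1 / (4 * B)" "h \<le> \<bar>e\<bar> / (16 * B\<^sup>2)"
      using p B e by (auto simp: h_def)
    have hB: "h * B \<le> 1 / 4" using h(3) B by (simp add: field_simps)
    have "h * \<bar>e\<bar> \<le> 8 * B\<^sup>2 * h\<^sup>2"
      using step[of h] step[of "- h"] h hB by (auto simp: abs_if)
    then have "h * \<bar>e\<bar> \<le> h * (8 * B\<^sup>2 * h)" by (simp add: power2_eq_square mult_ac)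
    then have "\<bar>e\<bar> \<le> 8 * B\<^sup>2 * h" using h(1) by simp
    also have "\<dots> \<le> 8 * B\<^sup>2 * (\<bar>e\<bar> / (16 * B\<^sup>2))" using h by (intro mult_left_mono) auto
    also have "\<dots> = \<bar>e\<bar> / 2" using B by (simp add: field_simps)
    finally show False using e by simp
  qed
  then show ?thesis by (simp add: e_def S_def)
qed

end

section \<open>Asymptotics of numbers and of random variables\<close>

abbreviation (input) bigO :: "nat \<Rightarrow> (real \<Rightarrow> real) set" where
  "bigO k \<equiv> O[at_right 0](\<lambda>\<epsilon>. \<epsilon> ^ k)"

lemma bigO_mult:
  assumes "f \<in> bigO j" "g \<in> bigO k"
  shows "(\<lambda>\<epsilon>. f \<epsilon> * g \<epsilon>) \<in> bigO (j + k)"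
  using landau_o.big.mult[OF assms] by (simp add: power_add)

lemma bigO_iff: "f \<in> bigO k \<longleftrightarrow> (\<exists>c. \<forall>\<^sub>F \<epsilon> in at_right 0. \<bar>f \<epsilon>\<bar> \<le> c * \<epsilon> ^ k)"
proof
  assume "f \<in> bigO k"
  then obtain c where "\<forall>\<^sub>F \<epsilon> in at_right 0. norm (f \<epsilon>) \<le> c * norm (\<epsilon> ^ k)"
    by (elim landau_o.bigE)
  with eventually_at_right_less[of "0::real"]
  have "\<forall>\<^sub>F \<epsilon> in at_right 0. \<bar>f \<epsilon>\<bar> \<le> c * \<epsilon> ^ k"
    by eventually_elim simp
  then show "\<exists>c. \<forall>\<^sub>F \<epsilon> in at_right 0. \<bar>f \<epsilon>\<bar> \<le> c * \<epsilon> ^ k" ..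
next
  assume "\<exists>c. \<forall>\<^sub>F \<epsilon> in at_right 0. \<bar>f \<epsilon>\<bar> \<le> c * \<epsilon> ^ k"
  then obtain c where c: "\<forall>\<^sub>F \<epsilon> in at_right 0. \<bar>f \<epsilon>\<bar> \<le> c * \<epsilon> ^ k" ..
  show "f \<in> bigO k"
  proof (rule landau_o.bigI[where c = "\<bar>c\<bar> + 1"])
    show "\<forall>\<^sub>F \<epsilon> in at_right 0. norm (f \<epsilon>) \<le> (\<bar>c\<bar> + 1) * norm (\<epsilon> ^ k)"
      using c eventually_at_right_less[of "0::real"]
    proof eventually_elim
      case (elim \<epsilon>)
      then have "c * \<epsilon> ^ k \<le> (\<bar>c\<bar> + 1) * \<epsilon> ^ k" by (intro mult_right_mono) auto
      from order_trans[OF elim(1) this] show ?case using elim by simp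
    qed
  qed simp
qed

lemma eventually_at_right_less_one: "\<forall>\<^sub>F \<epsilon> in at_right (0::real). 0 < \<epsilon> \<and> \<epsilon> < 1"
  using eventually_at_right_real[of 0 "1::real"] by simp

lemma bigO_mono:
  assumes "f \<in> bigO k" "j \<le> k"
  shows "f \<in> bigO j"
proof -
  have "(\<lambda>\<epsilon>::real. \<epsilon> ^ k) \<in> bigO j"
    unfolding bigO_iff
    by (rule exI[of _ 1], rule eventually_mono[OF eventually_at_right_less_one])
       (use assms(2) in \<open>auto intro: power_decreasing\<close>)
  with assms(1) show ?thesis by (rule landau_o.big_trans)
qed

lemma bigO_uminus: "f \<in> bigO k \<Longrightarrow> (\<lambda>\<epsilon>. - f \<epsilon>) \<in> bigO k"
  by simp

lemma bigO_const: "(\<lambda>_. c) \<in> bigO 0"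
  by simp

lemma bigO_cmult: "f \<in> bigO k \<Longrightarrow> (\<lambda>\<epsilon>. c * f \<epsilon>) \<in> bigO k"
  using bigO_mult[OF bigO_const] by fastforce

lemma bigO_monomial: "(\<lambda>\<epsilon>. c * \<epsilon> ^ k) \<in> bigO k"
  by (intro bigO_cmult) simp

lemma bigO_add: "f \<in> bigO k \<Longrightarrow> g \<in> bigO k \<Longrightarrow> (\<lambda>\<epsilon>. f \<epsilon> + g \<epsilon>) \<in> bigO k"
  by (rule sum_in_bigo)

lemma bigO_diff: "f \<in> bigO k \<Longrightarrow> g \<in> bigO k \<Longrightarrow> (\<lambda>\<epsilon>. f \<epsilon> - g \<epsilon>) \<in> bigO k"
  by (rule sum_in_bigo)

lemma bigO_product_approx:
  assumes "f \<in> bigO j" "(\<lambda>\<epsilon>. f \<epsilon> - F \<epsilon>) \<in> bigO (j + 1)"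
    and "G \<in> bigO k" "(\<lambda>\<epsilon>. g \<epsilon> - G \<epsilon>) \<in> bigO (k + 1)"
  shows "(\<lambda>\<epsilon>. f \<epsilon> * g \<epsilon> - F \<epsilon> * G \<epsilon>) \<in> bigO (j + k + 1)"
proof -
  have "(\<lambda>\<epsilon>. f \<epsilon> * (g \<epsilon> - G \<epsilon>) + (f \<epsilon> - F \<epsilon>) * G \<epsilon>) \<in> bigO (j + k + 1)"
    using bigO_mult[OF assms(1,4)] bigO_mult[OF assms(2,3)]
    by (intro sum_in_bigo) (simp_all add: add_ac)
  then show ?thesis by (simp add: algebra_simps)
qed

lemma bigO_cong:
  assumes "\<forall>\<^sub>F \<epsilon> in at_right 0. f \<epsilon> = g \<epsilon>" "g \<in> bigO k"
  shows "f \<in> bigO k"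
  using landau_o.big.in_cong[OF assms(1)] assms(2) by blast

text \<open>The constant bounds the random variable almost surely, so all moments inherit
the order, and orders add up under products.\<close>

definition random_bigO ::
    "(real \<Rightarrow> 'w measure) \<Rightarrow> nat \<Rightarrow> (real \<Rightarrow> 'w \<Rightarrow> real) \<Rightarrow> bool" where
  "random_bigO M k f \<longleftrightarrow> (\<exists>c. \<forall>\<^sub>F \<epsilon> in at_right 0.
     f \<epsilon> \<in> borel_measurable (M \<epsilon>) \<and> (AE \<omega> in M \<epsilon>. \<bar>f \<epsilon> \<omega>\<bar> \<le> c * \<epsilon> ^ k))"

lemma random_bigO_measurable:
  "random_bigO M k f \<Longrightarrow> \<forall>\<^sub>F \<epsilon> in at_right 0. f \<epsilon> \<in> borel_measurable (M \<epsilon>)"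
  unfolding random_bigO_def by (auto elim: eventually_mono)

lemma random_bigO_det: "f \<in> bigO k \<Longrightarrow> random_bigO M k (\<lambda>\<epsilon> \<omega>. f \<epsilon>)"
  unfolding random_bigO_def bigO_iff by (auto elim!: eventually_mono)

lemma random_bigO_mult:
  assumes "random_bigO M j f" "random_bigO M k g"
  shows "random_bigO M (j + k) (\<lambda>\<epsilon> \<omega>. f \<epsilon> \<omega> * g \<epsilon> \<omega>)"
proof -
  obtain c where c: "\<forall>\<^sub>F \<epsilon> in at_right 0.
     f \<epsilon> \<in> borel_measurable (M \<epsilon>) \<and> (AE \<omega> in M \<epsilon>. \<bar>f \<epsilon> \<omega>\<bar> \<le> c * \<epsilon> ^ j)"
    using assms(1) by (auto simp: random_bigO_def)
  obtain e where e: "\<forall>\<^sub>F \<epsilon> in at_right 0.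
     g \<epsilon> \<in> borel_measurable (M \<epsilon>) \<and> (AE \<omega> in M \<epsilon>. \<bar>g \<epsilon> \<omega>\<bar> \<le> e * \<epsilon> ^ k)"
    using assms(2) by (auto simp: random_bigO_def)
  have "\<forall>\<^sub>F \<epsilon> in at_right 0. (\<lambda>\<omega>. f \<epsilon> \<omega> * g \<epsilon> \<omega>) \<in> borel_measurable (M \<epsilon>) \<and>
     (AE \<omega> in M \<epsilon>. \<bar>f \<epsilon> \<omega> * g \<epsilon> \<omega>\<bar> \<le> (c * e) * \<epsilon> ^ (j + k))"
    using c e
  proof eventually_elim
    case (elim \<epsilon>)
    have "AE \<omega> in M \<epsilon>. \<bar>f \<epsilon> \<omega> * g \<epsilon> \<omega>\<bar> \<le> (c * e) * \<epsilon> ^ (j + k)"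
      using elim(1)[THEN conjunct2] elim(2)[THEN conjunct2]
    proof eventually_elim
      case (elim \<omega>)
      have "\<bar>f \<epsilon> \<omega>\<bar> * \<bar>g \<epsilon> \<omega>\<bar> \<le> (c * \<epsilon> ^ j) * (e * \<epsilon> ^ k)"
        using elim by (intro mult_mono) (auto intro: order_trans[OF abs_ge_zero])
      then show ?case by (simp add: abs_mult power_add mult_ac)
    qed
    then show ?case using elim by auto
  qed
  then show ?thesis unfolding random_bigO_def by blast
qed

lemma random_bigO_add:
  assumes "random_bigO M k f" "random_bigO M k g"
  shows "random_bigO M k (\<lambda>\<epsilon> \<omega>. f \<epsilon> \<omega> + g \<epsilon> \<omega>)"
proof -
  obtain c where c: "\<forall>\<^sub>F \<epsilon> in at_right 0.
     f \<epsilon> \<in> borel_measurable (M \<epsilon>) \<and> (AE \<omega> in M \<epsilon>. \<bar>f \<epsilon> \<omega>\<bar> \<le> c * \<epsilon> ^ k)"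
    using assms(1) by (auto simp: random_bigO_def)
  obtain e where e: "\<forall>\<^sub>F \<epsilon> in at_right 0.
     g \<epsilon> \<in> borel_measurable (M \<epsilon>) \<and> (AE \<omega> in M \<epsilon>. \<bar>g \<epsilon> \<omega>\<bar> \<le> e * \<epsilon> ^ k)"
    using assms(2) by (auto simp: random_bigO_def)
  have "\<forall>\<^sub>F \<epsilon> in at_right 0. (\<lambda>\<omega>. f \<epsilon> \<omega> + g \<epsilon> \<omega>) \<in> borel_measurable (M \<epsilon>) \<and>
     (AE \<omega> in M \<epsilon>. \<bar>f \<epsilon> \<omega> + g \<epsilon> \<omega>\<bar> \<le> (c + e) * \<epsilon> ^ k)"
    using c e
  proof eventually_elim
    case (elim \<epsilon>)
    have "AE \<omega> in M \<epsilon>. \<bar>f \<epsilon> \<omega> + g \<epsilon> \<omega>\<bar> \<le> (c + e) * \<epsilon> ^ k"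
      using elim(1)[THEN conjunct2] elim(2)[THEN conjunct2]
      by eventually_elim (simp add: distrib_right)
    then show ?case using elim by auto
  qed
  then show ?thesis unfolding random_bigO_def by blast
qed

lemma random_bigO_sum:
  assumes "finite A" "\<And>p. p \<in> A \<Longrightarrow> random_bigO M k (f p)"
  shows "random_bigO M k (\<lambda>\<epsilon> \<omega>. \<Sum>p\<in>A. f p \<epsilon> \<omega>)"
  using assms
  by (induction A rule: finite_induct)
     (auto intro!: random_bigO_add random_bigO_det[where f = "\<lambda>_. 0"])

lemma random_bigO_power:
  assumes "random_bigO M k f"
  shows "random_bigO M (n * k) (\<lambda>\<epsilon> \<omega>. f \<epsilon> \<omega> ^ n)"
proof (induction n)
  case 0 then show ?case using random_bigO_det[OF bigO_const[of 1]] by simp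
next
  case (Suc n) then show ?case using random_bigO_mult[OF assms Suc] by simp
qed

lemma random_bigO_half:
  assumes "random_bigO M (Suc k) u"
  shows "\<forall>\<^sub>F \<epsilon> in at_right 0. AE \<omega> in M \<epsilon>. \<bar>u \<epsilon> \<omega>\<bar> \<le> 1 / 2"
proof -
  obtain c where c: "\<forall>\<^sub>F \<epsilon> in at_right 0.
     u \<epsilon> \<in> borel_measurable (M \<epsilon>) \<and> (AE \<omega> in M \<epsilon>. \<bar>u \<epsilon> \<omega>\<bar> \<le> c * \<epsilon> ^ Suc k)"
    using assms by (auto simp: random_bigO_def)
  have "((\<lambda>\<epsilon>::real. c * \<epsilon> ^ Suc k) \<longlongrightarrow> c * 0 ^ Suc k) (at_right 0)"
    by (intro tendsto_intros)
  then have "\<forall>\<^sub>F \<epsilon> in at_right 0. c * \<epsilon> ^ Suc k < 1 / 2"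
    by (rule order_tendstoD(2)) simp
  with c show ?thesis
  proof eventually_elim
    case (elim \<epsilon>)
    from elim(1)[THEN conjunct2] show ?case by eventually_elim (use elim(2) in auto)
  qed
qed

text \<open>Writing \<open>v = 1 / (1 + u)\<close>, so that \<open>v * (1 + u) = 1\<close>, the remainder \<open>r n\<close> satisfies
\<open>r (n + 1) = v * r n + (n + 1) * v * u\<^sup>2\<close> with \<open>v \<le> 2\<close>; the constant solves the recursion
\<open>c (n + 1) = 2 * c n + 2 * (n + 1)\<close>.\<close>

lemma reciprocal_power_expansion:
  fixes u :: real
  assumes "\<bar>u\<bar> \<le> 1 / 2"
  shows "\<bar>(1 / (1 + u)) ^ n - 1 + real n * u\<bar> \<le> 2 * (\<Sum>i\<le>n. real i * 2 ^ (n - i)) * u\<^sup>2"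
proof (induction n)
  case 0 then show ?case by simp
next
  case (Suc n)
  define v where "v = 1 / (1 + u)"
  have v: "0 < v" "v \<le> 2" "v * (1 + u) = 1"
    using assms by (auto simp: v_def field_simps abs_if split: if_splits)
  define s where "s k = (\<Sum>i\<le>k. real i * 2 ^ (k - i))" for k :: nat
  have s_Suc: "s (Suc n) = 2 * s n + real (Suc n)"
    unfolding s_def by (simp add: sum_distrib_left Suc_diff_le mult_ac)
  have "v ^ Suc n - 1 + real (Suc n) * u
      = v * (v ^ n - 1 + real n * u) + real (Suc n) * (v * u\<^sup>2)"
  proof -
    have "v ^ Suc n - 1 + real (Suc n) * u
        = v * v ^ n - v * (1 + u) + real (Suc n) * u * (v * (1 + u))"
      by (simp add: v(3))
    then show ?thesis by (simp add: algebra_simps power2_eq_square)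
  qed
  also have "\<bar>\<dots>\<bar> \<le> \<bar>v * (v ^ n - 1 + real n * u)\<bar> + \<bar>real (Suc n) * (v * u\<^sup>2)\<bar>"
    by (rule abs_triangle_ineq)
  also have "\<dots> \<le> 2 * (2 * s n * u\<^sup>2) + real (Suc n) * (2 * u\<^sup>2)"
    unfolding abs_mult using v Suc
    by (intro add_mono mult_mono mult_nonneg_nonneg) (auto simp: s_def v_def sum_nonneg)
  also have "\<dots> = 2 * s (Suc n) * u\<^sup>2"
    by (simp add: s_Suc algebra_simps)
  finally show ?case by (simp add: v_def s_def)
qed

lemma random_bigO_dominated:
  assumes g: "random_bigO M k g"
    and meas: "\<forall>\<^sub>F \<epsilon> in at_right 0. f \<epsilon> \<in> borel_measurable (M \<epsilon>)"
    and dom: "\<forall>\<^sub>F \<epsilon> in at_right 0. AE \<omega> in M \<epsilon>. \<bar>f \<epsilon> \<omega>\<bar> \<le> C * \<bar>g \<epsilon> \<omega>\<bar>" and C: "0 \<le> C"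
  shows "random_bigO M k f"
proof -
  obtain c where c: "\<forall>\<^sub>F \<epsilon> in at_right 0.
     g \<epsilon> \<in> borel_measurable (M \<epsilon>) \<and> (AE \<omega> in M \<epsilon>. \<bar>g \<epsilon> \<omega>\<bar> \<le> c * \<epsilon> ^ k)"
    using g by (auto simp: random_bigO_def)
  have "\<forall>\<^sub>F \<epsilon> in at_right 0. f \<epsilon> \<in> borel_measurable (M \<epsilon>) \<and>
     (AE \<omega> in M \<epsilon>. \<bar>f \<epsilon> \<omega>\<bar> \<le> (C * c) * \<epsilon> ^ k)"
    using c meas dom
  proof eventually_elim
    case (elim \<epsilon>)
    from elim(1)[THEN conjunct2] elim(3)
    have "AE \<omega> in M \<epsilon>. \<bar>f \<epsilon> \<omega>\<bar> \<le> (C * c) * \<epsilon> ^ k"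
    proof eventually_elim
      case (elim \<omega>)
      have "C * \<bar>g \<epsilon> \<omega>\<bar> \<le> C * (c * \<epsilon> ^ k)" using elim C by (intro mult_left_mono) auto
      then show ?case using elim by (simp add: mult_ac)
    qed
    with elim show ?case by blast
  qed
  then show ?thesis unfolding random_bigO_def by blast
qed

lemma random_bigO_reciprocal_power_expansion:
  assumes u: "random_bigO M 1 u"
  shows "random_bigO M 2 (\<lambda>\<epsilon> \<omega>. (1 / (1 + u \<epsilon> \<omega>)) ^ n - 1 + real n * u \<epsilon> \<omega>)"
proof (rule random_bigO_dominated[where g = "\<lambda>\<epsilon> \<omega>. u \<epsilon> \<omega> ^ 2" and
      C = "2 * (\<Sum>i\<le>n. real i * 2 ^ (n - i))"])
  show "random_bigO M 2 (\<lambda>\<epsilon> \<omega>. u \<epsilon> \<omega> ^ 2)"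
    using random_bigO_power[OF u, of 2] by simp
  show "\<forall>\<^sub>F \<epsilon> in at_right 0.
      (\<lambda>\<omega>. (1 / (1 + u \<epsilon> \<omega>)) ^ n - 1 + real n * u \<epsilon> \<omega>) \<in> borel_measurable (M \<epsilon>)"
    using random_bigO_measurable[OF u] by eventually_elim simp
  show "\<forall>\<^sub>F \<epsilon> in at_right 0. AE \<omega> in M \<epsilon>. \<bar>(1 / (1 + u \<epsilon> \<omega>)) ^ n - 1 + real n * u \<epsilon> \<omega>\<bar>
      \<le> 2 * (\<Sum>i\<le>n. real i * 2 ^ (n - i)) * \<bar>u \<epsilon> \<omega> ^ 2\<bar>"
    using random_bigO_half[OF u[unfolded One_nat_def]]
  proof eventually_elim
    case (elim \<epsilon>)
    then show ?case
    proof eventually_elim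
      case (elim \<omega>)
      from reciprocal_power_expansion[OF this, of n] show ?case by simp
    qed
  qed
qed (auto intro: sum_nonneg)

lemma random_bigO_reciprocal_power:
  assumes u: "random_bigO M 1 u"
  shows "random_bigO M 0 (\<lambda>\<epsilon> \<omega>. (1 / (1 + u \<epsilon> \<omega>)) ^ n)"
proof (rule random_bigO_dominated[where g = "\<lambda>\<epsilon> \<omega>. 1" and C = "2 ^ n"])
  show "random_bigO M 0 (\<lambda>\<epsilon> \<omega>. 1)"
    by (rule random_bigO_det) simp
  show "\<forall>\<^sub>F \<epsilon> in at_right 0. (\<lambda>\<omega>. (1 / (1 + u \<epsilon> \<omega>)) ^ n) \<in> borel_measurable (M \<epsilon>)"
    using random_bigO_measurable[OF u] by eventually_elim measurable
  show "\<forall>\<^sub>F \<epsilon> in at_right 0. AE \<omega> in M \<epsilon>. \<bar>(1 / (1 + u \<epsilon> \<omega>)) ^ n\<bar> \<le> 2 ^ n * \<bar>1\<bar>"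
    using random_bigO_half[OF u[unfolded One_nat_def]]
  proof eventually_elim
    case (elim \<epsilon>)
    then show ?case
    proof eventually_elim
      case (elim \<omega>)
      have "\<bar>1 / (1 + u \<epsilon> \<omega>)\<bar> \<le> 2" using elim by (auto simp: abs_if field_simps split: if_splits)
      then have "\<bar>1 / (1 + u \<epsilon> \<omega>)\<bar> ^ n \<le> 2 ^ n" by (intro power_mono) auto
      then show ?case by (simp add: power_abs)
    qed
  qed
qed auto

lemma random_bigO_integrable:
  assumes "\<forall>\<^sub>F \<epsilon> in at_right 0. prob_space (M \<epsilon>)" "random_bigO M k f"
  shows "\<forall>\<^sub>F \<epsilon> in at_right 0. integrable (M \<epsilon>) (f \<epsilon>)"
proof -
  obtain c where c: "\<forall>\<^sub>F \<epsilon> in at_right 0.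
     f \<epsilon> \<in> borel_measurable (M \<epsilon>) \<and> (AE \<omega> in M \<epsilon>. \<bar>f \<epsilon> \<omega>\<bar> \<le> c * \<epsilon> ^ k)"
    using assms(2) by (auto simp: random_bigO_def)
  with assms(1) show ?thesis
    by eventually_elim (auto intro: prob_space.integrable_AE_bounded)
qed

lemma random_bigO_integral:
  assumes "\<forall>\<^sub>F \<epsilon> in at_right 0. prob_space (M \<epsilon>)" "random_bigO M k f"
  shows "(\<lambda>\<epsilon>. \<integral>\<omega>. f \<epsilon> \<omega> \<partial>M \<epsilon>) \<in> bigO k"
proof -
  obtain c where c: "\<forall>\<^sub>F \<epsilon> in at_right 0.
     f \<epsilon> \<in> borel_measurable (M \<epsilon>) \<and> (AE \<omega> in M \<epsilon>. \<bar>f \<epsilon> \<omega>\<bar> \<le> c * \<epsilon> ^ k)"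
    using assms(2) by (auto simp: random_bigO_def)
  have "\<forall>\<^sub>F \<epsilon> in at_right 0. \<bar>\<integral>\<omega>. f \<epsilon> \<omega> \<partial>M \<epsilon>\<bar> \<le> c * \<epsilon> ^ k"
    using c assms(1)
  proof eventually_elim
    case (elim \<epsilon>)
    interpret prob_space "M \<epsilon>" by (rule elim)
    have int: "integrable (M \<epsilon>) (f \<epsilon>)" using elim by (auto intro: integrable_AE_bounded)
    have "\<bar>\<integral>\<omega>. f \<epsilon> \<omega> \<partial>M \<epsilon>\<bar> \<le> (\<integral>\<omega>. \<bar>f \<epsilon> \<omega>\<bar> \<partial>M \<epsilon>)"
      by (rule integral_abs_bound)
    also have "\<dots> \<le> (\<integral>\<omega>. c * \<epsilon> ^ k \<partial>M \<epsilon>)"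
      using elim int by (intro integral_mono_AE) auto
    finally show ?case by (simp add: prob_space)
  qed
  then show ?thesis unfolding bigO_iff by blast
qed

section \<open>Optimal portfolios at low edge\<close>

definition log_growth :: "'w measure \<Rightarrow> 'i set \<Rightarrow> ('i \<Rightarrow> 'w \<Rightarrow> real) \<Rightarrow> ('i \<Rightarrow> real) \<Rightarrow> ereal" where
  "log_growth M I W x = ext_expectation M (\<lambda>\<omega>. ext_ln (1 + (\<Sum>p\<in>I. x p * W p \<omega>)))"

definition interior_optimum :: "'w measure \<Rightarrow> 'i set \<Rightarrow> ('i \<Rightarrow> 'w \<Rightarrow> real) \<Rightarrow> ('i \<Rightarrow> real) \<Rightarrow> bool" where
  "interior_optimum M I W x \<longleftrightarrow> (\<forall>p\<in>I. 0 < x p) \<and>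
     (\<forall>y. (\<forall>p\<in>I. 0 \<le> y p) \<longrightarrow> log_growth M I W y \<le> log_growth M I W x)"

text \<open>\<open>Q\<close> is the limiting second-moment matrix, \<open>P\<close> its inverse and \<open>\<alpha>\<close> the solution of \<open>Q \<alpha> = a\<close>.  Taking
\<open>\<alpha>\<close> through this equation, rather than as \<open>P a\<close>, lets all assumptions pass to a set of
coordinates on which \<open>Q\<close> splits off.\<close>

locale low_edge =
  fixes M :: "real \<Rightarrow> 'w measure" and I :: "'i set" and W :: "real \<Rightarrow> 'i \<Rightarrow> 'w \<Rightarrow> real"
    and B :: real and a \<alpha> :: "'i \<Rightarrow> real" and Q P :: "'i \<Rightarrow> 'i \<Rightarrow> real"
  assumes prob: "\<forall>\<^sub>F \<epsilon> in at_right 0. prob_space (M \<epsilon>)"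
    and fin: "finite I" and B_pos: "0 < B"
    and meas: "p \<in> I \<Longrightarrow> \<forall>\<^sub>F \<epsilon> in at_right 0. W \<epsilon> p \<in> borel_measurable (M \<epsilon>)"
    and bounded: "p \<in> I \<Longrightarrow> \<forall>\<^sub>F \<epsilon> in at_right 0. AE \<omega> in M \<epsilon>. \<bar>W \<epsilon> p \<omega>\<bar> \<le> B"
    and mean: "p \<in> I \<Longrightarrow> (\<lambda>\<epsilon>. (\<integral>\<omega>. W \<epsilon> p \<omega> \<partial>M \<epsilon>) - a p * \<epsilon>) \<in> bigO 2"
    and second_moment: "p \<in> I \<Longrightarrow> q \<in> I \<Longrightarrow>
      (\<lambda>\<epsilon>. (\<integral>\<omega>. W \<epsilon> p \<omega> * W \<epsilon> q \<omega> \<partial>M \<epsilon>) - Q p q) \<in> bigO 1"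
    and Q_sym: "p \<in> I \<Longrightarrow> q \<in> I \<Longrightarrow> Q p q = Q q p"
    and Q_psd: "0 \<le> (\<Sum>p\<in>I. \<Sum>q\<in>I. y p * Q p q * y q)"
    and P_left_inverse: "p \<in> I \<Longrightarrow> r \<in> I \<Longrightarrow> (\<Sum>q\<in>I. P p q * Q q r) = (if p = r then 1 else 0)"
    and Q_alpha: "p \<in> I \<Longrightarrow> (\<Sum>q\<in>I. Q p q * \<alpha> q) = a p"
begin

lemma W_random_bigO: "p \<in> I \<Longrightarrow> random_bigO M 0 (\<lambda>\<epsilon>. W \<epsilon> p)"
  unfolding random_bigO_def using eventually_conj[OF meas bounded, of p]
  by (intro exI[of _ B]) simp

lemma mean_bigO: "p \<in> I \<Longrightarrow> (\<lambda>\<epsilon>. \<integral>\<omega>. W \<epsilon> p \<omega> \<partial>M \<epsilon>) \<in> bigO 1"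
  using sum_in_bigo(1)[OF bigO_mono[OF mean, of p 1] bigO_monomial[of "a p" 1]] by simp

lemma portfolio_random_bigO:
  assumes "K \<subseteq> I" "\<And>p. p \<in> K \<Longrightarrow> (\<lambda>\<epsilon>. x \<epsilon> p) \<in> bigO k"
  shows "random_bigO M k (\<lambda>\<epsilon> \<omega>. \<Sum>p\<in>K. x \<epsilon> p * W \<epsilon> p \<omega>)"
proof (rule random_bigO_sum)
  show "finite K" using assms(1) fin by (rule finite_subset)
  fix p assume "p \<in> K"
  then show "random_bigO M k (\<lambda>\<epsilon> \<omega>. x \<epsilon> p * W \<epsilon> p \<omega>)"
    using random_bigO_mult[OF random_bigO_det[OF assms(2)] W_random_bigO] assms(1) by fastforce
qed

lemma solve_linear_bigO:
  assumes f: "\<And>p. p \<in> I \<Longrightarrow> (\<lambda>\<epsilon>. \<Sum>q\<in>I. Q p q * f \<epsilon> q) \<in> bigO k" and r: "r \<in> I"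
  shows "(\<lambda>\<epsilon>. f \<epsilon> r) \<in> bigO k"
proof -
  have "(\<Sum>p\<in>I. P r p * (\<Sum>q\<in>I. Q p q * f \<epsilon> q)) = f \<epsilon> r" for \<epsilon>
  proof -
    have "(\<Sum>p\<in>I. P r p * (\<Sum>q\<in>I. Q p q * f \<epsilon> q)) = (\<Sum>q\<in>I. \<Sum>p\<in>I. P r p * Q p q * f \<epsilon> q)"
      by (subst sum.swap) (simp add: sum_distrib_left mult_ac)
    also have "\<dots> = (\<Sum>q\<in>I. if r = q then f \<epsilon> q else 0)"
      by (intro sum.cong refl) (simp add: P_left_inverse[OF r] flip: sum_distrib_right)
    finally show ?thesis using fin r by simp
  qed
  moreover have "(\<lambda>\<epsilon>. \<Sum>p\<in>I. P r p * (\<Sum>q\<in>I. Q p q * f \<epsilon> q)) \<in> bigO k"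
    by (intro big_sum_in_bigo bigO_cmult f)
  ultimately show ?thesis by simp
qed

lemma second_moment_form:
  assumes p: "p \<in> I" and K: "K \<subseteq> I" and x: "\<And>q. q \<in> K \<Longrightarrow> (\<lambda>\<epsilon>. x \<epsilon> q) \<in> bigO k"
  shows "(\<lambda>\<epsilon>. (\<integral>\<omega>. W \<epsilon> p \<omega> * (\<Sum>q\<in>K. x \<epsilon> q * W \<epsilon> q \<omega>) \<partial>M \<epsilon>) - (\<Sum>q\<in>K. Q p q * x \<epsilon> q))
    \<in> bigO (k + 1)"
proof (rule bigO_cong)
  have finK: "finite K" using K fin by (rule finite_subset)
  have "\<forall>\<^sub>F \<epsilon> in at_right 0. \<forall>q\<in>K. integrable (M \<epsilon>) (\<lambda>\<omega>. W \<epsilon> p \<omega> * W \<epsilon> q \<omega>)"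
  proof (rule eventually_ball_finite[OF finK], intro ballI)
    fix q assume "q \<in> K"
    then show "\<forall>\<^sub>F \<epsilon> in at_right 0. integrable (M \<epsilon>) (\<lambda>\<omega>. W \<epsilon> p \<omega> * W \<epsilon> q \<omega>)"
      using K p by (intro random_bigO_integrable[OF prob random_bigO_mult[OF W_random_bigO W_random_bigO]]) auto
  qed
  then show "\<forall>\<^sub>F \<epsilon> in at_right 0.
      (\<integral>\<omega>. W \<epsilon> p \<omega> * (\<Sum>q\<in>K. x \<epsilon> q * W \<epsilon> q \<omega>) \<partial>M \<epsilon>) - (\<Sum>q\<in>K. Q p q * x \<epsilon> q)
      = (\<Sum>q\<in>K. x \<epsilon> q * ((\<integral>\<omega>. W \<epsilon> p \<omega> * W \<epsilon> q \<omega> \<partial>M \<epsilon>) - Q p q))"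
  proof eventually_elim
    case (elim \<epsilon>)
    have "(\<integral>\<omega>. W \<epsilon> p \<omega> * (\<Sum>q\<in>K. x \<epsilon> q * W \<epsilon> q \<omega>) \<partial>M \<epsilon>)
        = (\<integral>\<omega>. (\<Sum>q\<in>K. x \<epsilon> q * (W \<epsilon> p \<omega> * W \<epsilon> q \<omega>)) \<partial>M \<epsilon>)"
      by (simp add: sum_distrib_left mult_ac)
    also have "\<dots> = (\<Sum>q\<in>K. x \<epsilon> q * (\<integral>\<omega>. W \<epsilon> p \<omega> * W \<epsilon> q \<omega> \<partial>M \<epsilon>))"
      using elim by (subst Bochner_Integration.integral_sum) auto
    finally show ?case by (simp add: right_diff_distrib sum_subtractf mult_ac)
  qed
  show "(\<lambda>\<epsilon>. \<Sum>q\<in>K. x \<epsilon> q * ((\<integral>\<omega>. W \<epsilon> p \<omega> * W \<epsilon> q \<omega> \<partial>M \<epsilon>) - Q p q)) \<in> bigO (k + 1)"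
    using K p by (intro big_sum_in_bigo bigO_mult x second_moment) auto
qed

text \<open>The second-moment form differs from the coercive limiting form by at most \<open>\<nu> * (\<Sum>p\<in>I. \<bar>y p\<bar>)\<^sup>2\<close>
with \<open>\<nu>\<close> as small as desired, uniformly in \<open>y\<close>.\<close>

lemma coercive:
  "\<exists>\<mu>>0. \<forall>\<^sub>F \<epsilon> in at_right 0. \<forall>y. \<mu> * (\<Sum>p\<in>I. \<bar>y p\<bar>)\<^sup>2 \<le> (\<integral>\<omega>. (\<Sum>p\<in>I. y p * W \<epsilon> p \<omega>)\<^sup>2 \<partial>M \<epsilon>)"
proof -
  have "\<exists>\<kappa>>0. \<forall>y. (\<Sum>p\<in>I. \<bar>y p\<bar>)\<^sup>2 \<le> \<kappa> * (\<Sum>p\<in>I. \<Sum>q\<in>I. y p * Q p q * y q)"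
    by (rule finite_quadratic_form_coercive[where P = P]) (rule fin Q_sym Q_psd P_left_inverse; assumption)+
  then obtain \<kappa> where \<kappa>: "0 < \<kappa>"
    "\<And>y. (\<Sum>p\<in>I. \<bar>y p\<bar>)\<^sup>2 \<le> \<kappa> * (\<Sum>p\<in>I. \<Sum>q\<in>I. y p * Q p q * y q)"
    by blast
  \<comment> \<open>Half of the coercivity constant \<open>1 / \<kappa>\<close> is spent on the perturbation, the other half is kept.\<close>
  define \<nu> where "\<nu> = 1 / (2 * \<kappa>)"
  have \<nu>: "0 < \<nu>" using \<kappa>(1) by (simp add: \<nu>_def)
  have close: "\<forall>\<^sub>F \<epsilon> in at_right 0. \<forall>p\<in>I. \<forall>q\<in>I.
      \<bar>(\<integral>\<omega>. W \<epsilon> p \<omega> * W \<epsilon> q \<omega> \<partial>M \<epsilon>) - Q p q\<bar> \<le> \<nu>"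
  proof (intro eventually_ball_finite[OF fin] ballI)
    fix p q assume "p \<in> I" "q \<in> I"
    then obtain c where c: "\<forall>\<^sub>F \<epsilon> in at_right 0. \<bar>(\<integral>\<omega>. W \<epsilon> p \<omega> * W \<epsilon> q \<omega> \<partial>M \<epsilon>) - Q p q\<bar> \<le> c * \<epsilon> ^ 1"
      using second_moment[of p q] unfolding bigO_iff by blast
    have "((\<lambda>\<epsilon>::real. c * \<epsilon> ^ 1) \<longlongrightarrow> c * 0 ^ 1) (at_right 0)" by (intro tendsto_intros)
    then have "\<forall>\<^sub>F \<epsilon> in at_right 0. c * \<epsilon> ^ 1 < \<nu>" by (rule order_tendstoD(2)) (use \<nu> in simp)
    with c show "\<forall>\<^sub>F \<epsilon> in at_right 0. \<bar>(\<integral>\<omega>. W \<epsilon> p \<omega> * W \<epsilon> q \<omega> \<partial>M \<epsilon>) - Q p q\<bar> \<le> \<nu>"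
      by eventually_elim auto
  qed
  have int: "\<forall>\<^sub>F \<epsilon> in at_right 0. \<forall>p\<in>I. \<forall>q\<in>I. integrable (M \<epsilon>) (\<lambda>\<omega>. W \<epsilon> p \<omega> * W \<epsilon> q \<omega>)"
    by (intro eventually_ball_finite[OF fin] ballI
        random_bigO_integrable[OF prob random_bigO_mult[OF W_random_bigO W_random_bigO]])
  have "\<forall>\<^sub>F \<epsilon> in at_right 0. \<forall>y. \<nu> * (\<Sum>p\<in>I. \<bar>y p\<bar>)\<^sup>2 \<le> (\<integral>\<omega>. (\<Sum>p\<in>I. y p * W \<epsilon> p \<omega>)\<^sup>2 \<partial>M \<epsilon>)"
    using close int
  proof eventually_elim
    case (elim \<epsilon>)
    show ?case
    proof
      fix y
      define m where "m p q = (\<integral>\<omega>. W \<epsilon> p \<omega> * W \<epsilon> q \<omega> \<partial>M \<epsilon>)" for p q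
      define F where "F = (\<Sum>p\<in>I. \<Sum>q\<in>I. y p * Q p q * y q)"
      define N where "N = (\<Sum>p\<in>I. \<bar>y p\<bar>)\<^sup>2"
      have "(\<integral>\<omega>. (\<Sum>p\<in>I. y p * W \<epsilon> p \<omega>)\<^sup>2 \<partial>M \<epsilon>)
          = (\<integral>\<omega>. (\<Sum>p\<in>I. \<Sum>q\<in>I. (y p * y q) * (W \<epsilon> p \<omega> * W \<epsilon> q \<omega>)) \<partial>M \<epsilon>)"
        by (simp add: power2_eq_square sum_product mult_ac)
      also have "\<dots> = (\<Sum>p\<in>I. \<Sum>q\<in>I. (y p * y q) * m p q)"
        unfolding m_def using elim(2)
        by (simp add: Bochner_Integration.integral_sum)
      finally have E: "(\<integral>\<omega>. (\<Sum>p\<in>I. y p * W \<epsilon> p \<omega>)\<^sup>2 \<partial>M \<epsilon>) = (\<Sum>p\<in>I. \<Sum>q\<in>I. (y p * y q) * m p q)" .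
      have "F - (\<Sum>p\<in>I. \<Sum>q\<in>I. (y p * y q) * m p q) = (\<Sum>p\<in>I. \<Sum>q\<in>I. (y p * y q) * (Q p q - m p q))"
        unfolding F_def by (simp add: algebra_simps sum_subtractf)
      also have "\<dots> \<le> (\<Sum>p\<in>I. \<Sum>q\<in>I. (\<bar>y p\<bar> * \<bar>y q\<bar>) * \<nu>)"
      proof (intro sum_mono)
        fix p q assume pq: "p \<in> I" "q \<in> I"
        have "(y p * y q) * (Q p q - m p q) \<le> \<bar>y p\<bar> * \<bar>y q\<bar> * \<bar>Q p q - m p q\<bar>"
          by (metis abs_ge_self abs_mult)
        also have "\<dots> \<le> (\<bar>y p\<bar> * \<bar>y q\<bar>) * \<nu>"
          using elim(1) pq by (intro mult_left_mono) (auto simp: m_def abs_minus_commute)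
        finally show "(y p * y q) * (Q p q - m p q) \<le> (\<bar>y p\<bar> * \<bar>y q\<bar>) * \<nu>" .
      qed
      also have "\<dots> = N * \<nu>"
        unfolding N_def power2_eq_square sum_product by (simp only: sum_distrib_right)
      finally have 1: "F - N * \<nu> \<le> (\<integral>\<omega>. (\<Sum>p\<in>I. y p * W \<epsilon> p \<omega>)\<^sup>2 \<partial>M \<epsilon>)" unfolding E by simp
      have "N \<le> \<kappa> * F" using \<kappa>(2)[of y] by (simp add: N_def F_def)
      then have "2 * N * \<nu> \<le> F" using \<kappa>(1) by (simp add: \<nu>_def field_simps)
      with 1 show "\<nu> * (\<Sum>p\<in>I. \<bar>y p\<bar>)\<^sup>2 \<le> (\<integral>\<omega>. (\<Sum>p\<in>I. y p * W \<epsilon> p \<omega>)\<^sup>2 \<partial>M \<epsilon>)"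
        unfolding N_def[symmetric] by (simp add: mult_ac)
    qed
  qed
  with \<nu> show ?thesis by blast
qed

context
  fixes x :: "real \<Rightarrow> 'i \<Rightarrow> real"
  assumes opt: "\<forall>\<^sub>F \<epsilon> in at_right 0. interior_optimum (M \<epsilon>) I (W \<epsilon>) (x \<epsilon>)"
begin

lemma optimum_bigO:
  assumes p: "p \<in> I"
  shows "(\<lambda>\<epsilon>. x \<epsilon> p) \<in> bigO 1"
proof -
  obtain \<mu> where \<mu>: "0 < \<mu>" and
    form: "\<forall>\<^sub>F \<epsilon> in at_right 0. \<forall>y. \<mu> * (\<Sum>p\<in>I. \<bar>y p\<bar>)\<^sup>2 \<le> (\<integral>\<omega>. (\<Sum>p\<in>I. y p * W \<epsilon> p \<omega>)\<^sup>2 \<partial>M \<epsilon>)"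
    using coercive by blast
  have "\<forall>q\<in>I. \<exists>c. \<forall>\<^sub>F \<epsilon> in at_right 0. \<bar>\<integral>\<omega>. W \<epsilon> q \<omega> \<partial>M \<epsilon>\<bar> \<le> c * \<epsilon> ^ 1"
    using mean_bigO unfolding bigO_iff by blast
  then obtain c where c: "\<And>q. q \<in> I \<Longrightarrow> \<forall>\<^sub>F \<epsilon> in at_right 0. \<bar>\<integral>\<omega>. W \<epsilon> q \<omega> \<partial>M \<epsilon>\<bar> \<le> c q * \<epsilon> ^ 1"
    by metis
  define \<eta> where "\<eta> = (\<Sum>q\<in>I. \<bar>c q\<bar>)"
  have \<eta>: "0 \<le> \<eta>" unfolding \<eta>_def by (intro sum_nonneg) auto
  have drift: "\<forall>\<^sub>F \<epsilon> in at_right 0. \<forall>q\<in>I. \<bar>\<integral>\<omega>. W \<epsilon> q \<omega> \<partial>M \<epsilon>\<bar> \<le> c q * \<epsilon>"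
    using c by (intro eventually_ball_finite[OF fin]) auto
  have m: "\<forall>\<^sub>F \<epsilon> in at_right 0. \<forall>q\<in>I. W \<epsilon> q \<in> borel_measurable (M \<epsilon>)"
    using meas by (intro eventually_ball_finite[OF fin]) auto
  have bd: "\<forall>\<^sub>F \<epsilon> in at_right 0. \<forall>q\<in>I. AE \<omega> in M \<epsilon>. \<bar>W \<epsilon> q \<omega>\<bar> \<le> B"
    using bounded by (intro eventually_ball_finite[OF fin]) auto
  have "((\<lambda>\<epsilon>::real. 4 * (\<eta> * \<epsilon>) * B) \<longlongrightarrow> 4 * (\<eta> * 0) * B) (at_right 0)"
    by (intro tendsto_intros)
  then have sm: "\<forall>\<^sub>F \<epsilon> in at_right 0. 4 * (\<eta> * \<epsilon>) * B < \<mu>"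
    by (rule order_tendstoD(2)) (use \<mu> in simp)
  have "\<forall>\<^sub>F \<epsilon> in at_right 0. \<bar>x \<epsilon> p\<bar> \<le> 4 * \<eta> / \<mu> * \<epsilon> ^ 1"
    using form drift m bd sm opt prob eventually_at_right_less[of "0::real"]
  proof eventually_elim
    case (elim \<epsilon>)
    interpret prob_space "M \<epsilon>" by (rule elim)
    have x: "0 < x \<epsilon> q" if "q \<in> I" for q
      using elim(6) that by (auto simp: interior_optimum_def)
    have abs: "(\<Sum>p\<in>I. \<bar>x \<epsilon> p\<bar>) = (\<Sum>p\<in>I. x \<epsilon> p)"
      using x by (intro sum.cong refl abs_of_pos)
    have "log_growth (M \<epsilon>) I (W \<epsilon>) (\<lambda>_. 0) \<le> log_growth (M \<epsilon>) I (W \<epsilon>) (x \<epsilon>)"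
      using elim(6) by (auto simp: interior_optimum_def)
    then have nonneg: "0 \<le> ext_expectation (M \<epsilon>) (\<lambda>\<omega>. ext_ln (1 + (\<Sum>p\<in>I. x \<epsilon> p * W \<epsilon> p \<omega>)))"
      by (simp add: log_growth_def)
    have "(\<Sum>p\<in>I. x \<epsilon> p) \<le> 4 * (\<eta> * \<epsilon>) / \<mu>"
    proof (rule portfolio_localized[where W = "W \<epsilon>" and B = B])
      fix q assume q: "q \<in> I"
      have "c q \<le> \<eta>"
        unfolding \<eta>_def using member_le_sum[of q I "\<lambda>q. \<bar>c q\<bar>"] q fin by auto
      then have "c q * \<epsilon> \<le> \<eta> * \<epsilon>" using elim by (intro mult_right_mono) auto
      then show "(\<integral>\<omega>. W \<epsilon> q \<omega> \<partial>M \<epsilon>) \<le> \<eta> * \<epsilon>"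
        using elim(2) q by force
      show "W \<epsilon> q \<in> borel_measurable (M \<epsilon>)" "AE \<omega> in M \<epsilon>. \<bar>W \<epsilon> q \<omega>\<bar> \<le> B"
        using elim q by auto
      show "0 \<le> x \<epsilon> q" using x[OF q] by simp
    next
      show "\<mu> * (\<Sum>p\<in>I. x \<epsilon> p)\<^sup>2 \<le> (\<integral>\<omega>. (\<Sum>p\<in>I. x \<epsilon> p * W \<epsilon> p \<omega>)\<^sup>2 \<partial>M \<epsilon>)"
        using elim(1) abs by metis
    qed (use fin B_pos nonneg \<eta> \<mu> elim in auto)
    moreover have "x \<epsilon> p \<le> (\<Sum>p\<in>I. x \<epsilon> p)"
      using x fin p by (intro member_le_sum) (auto intro: less_imp_le)
    ultimately show ?case using x[OF p] by simp
  qed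
  then show ?thesis unfolding bigO_iff by blast
qed

lemma optimum_random_bigO: "K \<subseteq> I \<Longrightarrow> random_bigO M 1 (\<lambda>\<epsilon> \<omega>. \<Sum>p\<in>K. x \<epsilon> p * W \<epsilon> p \<omega>)"
  using optimum_bigO by (intro portfolio_random_bigO) auto

lemma optimum_first_order:
  "\<forall>\<^sub>F \<epsilon> in at_right 0. \<forall>p\<in>I. (\<integral>\<omega>. W \<epsilon> p \<omega> / (1 + (\<Sum>q\<in>I. x \<epsilon> q * W \<epsilon> q \<omega>)) \<partial>M \<epsilon>) = 0"
proof -
  have half: "\<forall>\<^sub>F \<epsilon> in at_right 0. AE \<omega> in M \<epsilon>. \<bar>\<Sum>q\<in>I. x \<epsilon> q * W \<epsilon> q \<omega>\<bar> \<le> 1 / 2"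
    using random_bigO_half[of M 0] optimum_random_bigO[of I] by simp
  have m: "\<forall>\<^sub>F \<epsilon> in at_right 0. \<forall>q\<in>I. W \<epsilon> q \<in> borel_measurable (M \<epsilon>)"
    using meas by (intro eventually_ball_finite[OF fin]) auto
  have bd: "\<forall>\<^sub>F \<epsilon> in at_right 0. \<forall>q\<in>I. AE \<omega> in M \<epsilon>. \<bar>W \<epsilon> q \<omega>\<bar> \<le> B"
    using bounded by (intro eventually_ball_finite[OF fin]) auto
  show ?thesis
    using half m bd opt prob
  proof eventually_elim
    case (elim \<epsilon>)
    interpret prob_space "M \<epsilon>" by (rule elim)
    show ?case
    proof
      fix p assume p: "p \<in> I"
      show "(\<integral>\<omega>. W \<epsilon> p \<omega> / (1 + (\<Sum>q\<in>I. x \<epsilon> q * W \<epsilon> q \<omega>)) \<partial>M \<epsilon>) = 0"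
        using elim p
        by (intro first_order_condition[OF fin _ _ _ _ _ p _ B_pos])
           (auto simp: interior_optimum_def log_growth_def intro: less_imp_le)
    qed
  qed
qed

text \<open>The first-order condition reads \<open>E[W p] - E[W p * S] + O(\<epsilon>\<^sup>2) = 0\<close>, that is
\<open>\<epsilon> * a p - (\<Sum>q\<in>I. Q p q * x q) = O(\<epsilon>\<^sup>2)\<close>; invert \<open>Q\<close>.\<close>

lemma optimum_first_approx:
  assumes r: "r \<in> I"
  shows "(\<lambda>\<epsilon>. x \<epsilon> r - \<alpha> r * \<epsilon>) \<in> bigO 2"
proof (rule solve_linear_bigO[OF _ r])
  fix p assume p: "p \<in> I"
  define S where "S \<epsilon> \<omega> = (\<Sum>q\<in>I. x \<epsilon> q * W \<epsilon> q \<omega>)" for \<epsilon> \<omega>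
  have S: "random_bigO M 1 S" unfolding S_def[abs_def] by (rule optimum_random_bigO) simp
  define r where "r \<epsilon> \<omega> = W \<epsilon> p \<omega> * ((1 / (1 + S \<epsilon> \<omega>)) ^ 1 - 1 + real 1 * S \<epsilon> \<omega>)" for \<epsilon> \<omega>
  have r: "random_bigO M 2 r"
    using random_bigO_mult[OF W_random_bigO[OF p] random_bigO_reciprocal_power_expansion[OF S, of 1]]
    by (simp add: r_def[abs_def] numeral_2_eq_2)
  have expansion: "\<forall>\<^sub>F \<epsilon> in at_right 0. (\<Sum>q\<in>I. Q p q * (x \<epsilon> q - \<alpha> q * \<epsilon>))
     = ((\<integral>\<omega>. W \<epsilon> p \<omega> \<partial>M \<epsilon>) - a p * \<epsilon>)
       - ((\<integral>\<omega>. W \<epsilon> p \<omega> * S \<epsilon> \<omega> \<partial>M \<epsilon>) - (\<Sum>q\<in>I. Q p q * x \<epsilon> q)) + (\<integral>\<omega>. r \<epsilon> \<omega> \<partial>M \<epsilon>)"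
    using optimum_first_order random_bigO_integrable[OF prob r]
      random_bigO_integrable[OF prob W_random_bigO[OF p]]
      random_bigO_integrable[OF prob random_bigO_mult[OF W_random_bigO[OF p] S]]
  proof eventually_elim
    case (elim \<epsilon>)
    have "0 = (\<integral>\<omega>. W \<epsilon> p \<omega> / (1 + S \<epsilon> \<omega>) \<partial>M \<epsilon>)" using elim(1) p by (simp add: S_def)
    also have "\<dots> = (\<integral>\<omega>. W \<epsilon> p \<omega> - W \<epsilon> p \<omega> * S \<epsilon> \<omega> + r \<epsilon> \<omega> \<partial>M \<epsilon>)"
      by (simp add: r_def algebra_simps)
    also have "\<dots> = (\<integral>\<omega>. W \<epsilon> p \<omega> \<partial>M \<epsilon>) - (\<integral>\<omega>. W \<epsilon> p \<omega> * S \<epsilon> \<omega> \<partial>M \<epsilon>) + (\<integral>\<omega>. r \<epsilon> \<omega> \<partial>M \<epsilon>)"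
      using elim by simp
    finally have 1: "(\<integral>\<omega>. W \<epsilon> p \<omega> \<partial>M \<epsilon>) - (\<integral>\<omega>. W \<epsilon> p \<omega> * S \<epsilon> \<omega> \<partial>M \<epsilon>) + (\<integral>\<omega>. r \<epsilon> \<omega> \<partial>M \<epsilon>) = 0"
      by simp
    have "(\<Sum>q\<in>I. Q p q * (x \<epsilon> q - \<alpha> q * \<epsilon>)) = (\<Sum>q\<in>I. Q p q * x \<epsilon> q) - (\<Sum>q\<in>I. Q p q * \<alpha> q) * \<epsilon>"
      by (simp add: right_diff_distrib sum_subtractf sum_distrib_left mult_ac)
    then show ?case using 1 Q_alpha[OF p] by simp
  qed
  have second: "(\<lambda>\<epsilon>. (\<integral>\<omega>. W \<epsilon> p \<omega> * S \<epsilon> \<omega> \<partial>M \<epsilon>) - (\<Sum>q\<in>I. Q p q * x \<epsilon> q)) \<in> bigO 2"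
    using second_moment_form[OF p subset_refl, where x = x and k = 1] optimum_bigO
    unfolding S_def by (simp add: numeral_2_eq_2)
  show "(\<lambda>\<epsilon>. \<Sum>q\<in>I. Q p q * (x \<epsilon> q - \<alpha> q * \<epsilon>)) \<in> bigO 2"
    by (rule bigO_cong[OF expansion bigO_add[OF bigO_diff[OF mean[OF p] second] random_bigO_integral[OF prob r]]])
qed

end

end

section \<open>Interaction of one block with the others\<close>

lemma (in low_edge) sub_block:
  assumes K: "K \<subseteq> I" and sep: "\<And>p q. p \<in> K \<Longrightarrow> q \<in> I - K \<Longrightarrow> Q p q = 0"
  shows "low_edge M K W B a \<alpha> Q P"
proof unfold_locales
  show finK: "finite K" using K fin by (rule finite_subset)
  show "0 \<le> (\<Sum>p\<in>K. \<Sum>q\<in>K. y p * Q p q * y q)" for y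
  proof -
    define z where "z p = (if p \<in> K then y p else 0)" for p
    have "0 \<le> (\<Sum>p\<in>I. \<Sum>q\<in>I. z p * Q p q * z q)" by (rule Q_psd)
    also have "\<dots> = (\<Sum>p\<in>K. \<Sum>q\<in>I. z p * Q p q * z q)"
      using fin K by (intro sum.mono_neutral_right) (auto simp: z_def)
    also have "\<dots> = (\<Sum>p\<in>K. \<Sum>q\<in>K. z p * Q p q * z q)"
      using fin K by (intro sum.cong refl sum.mono_neutral_right) (auto simp: z_def)
    also have "\<dots> = (\<Sum>p\<in>K. \<Sum>q\<in>K. y p * Q p q * y q)"
      by (intro sum.cong refl) (simp add: z_def)
    finally show ?thesis .
  qed
  fix p assume p: "p \<in> K"
  show "(\<Sum>q\<in>K. Q p q * \<alpha> q) = a p"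
  proof -
    have "(\<Sum>q\<in>K. Q p q * \<alpha> q) = (\<Sum>q\<in>I. Q p q * \<alpha> q)"
      using fin K sep p by (intro sum.mono_neutral_left) auto
    then show ?thesis using Q_alpha K p by auto
  qed
  fix r assume r: "r \<in> K"
  show "(\<Sum>q\<in>K. P p q * Q q r) = (if p = r then 1 else 0)"
  proof -
    have "Q q r = 0" if "q \<in> I - K" for q
      using sep[OF r that] Q_sym[of q r] that K r by auto
    then have "(\<Sum>q\<in>K. P p q * Q q r) = (\<Sum>q\<in>I. P p q * Q q r)"
      using fin K by (intro sum.mono_neutral_left) auto
    then show ?thesis using P_left_inverse[of p r] subsetD[OF K p] subsetD[OF K r] by simp
  qed
  show "(\<lambda>\<epsilon>. (\<integral>\<omega>. W \<epsilon> p \<omega> * W \<epsilon> r \<omega> \<partial>M \<epsilon>) - Q p r) \<in> bigO 1"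
    using K p r by (intro second_moment) auto
  show "Q p r = Q r p"
    using K p r by (intro Q_sym) auto
qed (use K prob B_pos meas bounded mean in auto)

text \<open>\<open>K\<close> is the set of coordinates of the block under study, \<open>x\<close> the joint and \<open>y\<close> the isolated optimum.\<close>

locale block_interaction = low_edge M I W B a \<alpha> Q P
  for M :: "real \<Rightarrow> 'w measure" and I :: "'i set" and W :: "real \<Rightarrow> 'i \<Rightarrow> 'w \<Rightarrow> real"
    and B :: real and a \<alpha> :: "'i \<Rightarrow> real" and Q P :: "'i \<Rightarrow> 'i \<Rightarrow> real" +
  fixes K :: "'i set" and x y :: "real \<Rightarrow> 'i \<Rightarrow> real"
  assumes K: "K \<subseteq> I"
    and sep: "p \<in> K \<Longrightarrow> q \<in> I - K \<Longrightarrow> Q p q = 0"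
    and indep: "\<forall>\<^sub>F \<epsilon> in at_right 0. prob_space.indep_var (M \<epsilon>)
      (\<Pi>\<^sub>M p\<in>K. borel) (\<lambda>\<omega>. \<lambda>p\<in>K. W \<epsilon> p \<omega>) (\<Pi>\<^sub>M p\<in>I - K. borel) (\<lambda>\<omega>. \<lambda>p\<in>I - K. W \<epsilon> p \<omega>)"
    and joint_opt: "\<forall>\<^sub>F \<epsilon> in at_right 0. interior_optimum (M \<epsilon>) I (W \<epsilon>) (x \<epsilon>)"
    and block_opt: "\<forall>\<^sub>F \<epsilon> in at_right 0. interior_optimum (M \<epsilon>) K (W \<epsilon>) (y \<epsilon>)"
begin

text \<open>Here \<open>u\<close> and \<open>w\<close> are the returns of the block and of the remaining coordinates under the joint
stakes, \<open>u'\<close> is the return of the block under the isolated stakes, and \<open>v\<close>, \<open>v'\<close> are the reciprocals of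
the wealth that the block alone produces.\<close>

definition \<Lambda> :: real where "\<Lambda> = (\<Sum>p\<in>I - K. a p * \<alpha> p)"
definition u where "u \<epsilon> \<omega> = (\<Sum>p\<in>K. x \<epsilon> p * W \<epsilon> p \<omega>)"
definition w where "w \<epsilon> \<omega> = (\<Sum>p\<in>I - K. x \<epsilon> p * W \<epsilon> p \<omega>)"
definition v where "v \<epsilon> \<omega> = 1 / (1 + u \<epsilon> \<omega>)"
definition u' where "u' \<epsilon> \<omega> = (\<Sum>p\<in>K. y \<epsilon> p * W \<epsilon> p \<omega>)"
definition v' where "v' \<epsilon> \<omega> = 1 / (1 + u' \<epsilon> \<omega>)"

sublocale K: low_edge M K W B a \<alpha> Q P
  by (rule sub_block[OF K sep])

lemma joint_split: "(\<Sum>p\<in>I. x \<epsilon> p * W \<epsilon> p \<omega>) = u \<epsilon> \<omega> + w \<epsilon> \<omega>"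
  unfolding u_def w_def using sum.subset_diff[OF K fin] by (simp add: add.commute)

lemma u_bigO: "random_bigO M 1 u" and w_bigO: "random_bigO M 1 w"
  and uw_bigO: "random_bigO M 1 (\<lambda>\<epsilon> \<omega>. u \<epsilon> \<omega> + w \<epsilon> \<omega>)"
  and u'_bigO: "random_bigO M 1 u'"
proof -
  show u: "random_bigO M 1 u" unfolding u_def[abs_def] using optimum_random_bigO[OF joint_opt K] .
  show w: "random_bigO M 1 w" unfolding w_def[abs_def] by (rule optimum_random_bigO[OF joint_opt]) auto
  show "random_bigO M 1 (\<lambda>\<epsilon> \<omega>. u \<epsilon> \<omega> + w \<epsilon> \<omega>)" by (rule random_bigO_add[OF u w])
  show "random_bigO M 1 u'" unfolding u'_def[abs_def] by (rule K.optimum_random_bigO[OF block_opt]) simp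
qed

lemma v_power_bigO: "random_bigO M 0 (\<lambda>\<epsilon> \<omega>. v \<epsilon> \<omega> ^ n)"
  unfolding v_def by (rule random_bigO_reciprocal_power[OF u_bigO])

lemma v_bigO: "random_bigO M 0 v"
  using v_power_bigO[of 1] by simp

lemma v'_bigO: "random_bigO M 0 v'"
  using random_bigO_reciprocal_power[OF u'_bigO, of 1] by (simp add: v'_def[abs_def])

lemma W_v_bigO: "p \<in> I \<Longrightarrow> random_bigO M 0 (\<lambda>\<epsilon> \<omega>. W \<epsilon> p \<omega> * v \<epsilon> \<omega> ^ n)"
  using random_bigO_mult[OF W_random_bigO v_power_bigO] by simp

lemma w_power_bigO: "random_bigO M n (\<lambda>\<epsilon> \<omega>. w \<epsilon> \<omega> ^ n)"
  using random_bigO_power[OF w_bigO, of n] by simp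

text \<open>If row \<open>p\<close> of \<open>Q\<close> is supported on \<open>L\<close>, the coordinates in \<open>L\<close> suffice to reproduce
\<open>Q \<alpha> = a\<close> in that row.  Thus \<open>E[W p * u]\<close> and \<open>E[W p * w]\<close> agree with the mean of \<open>W p\<close> to first order
for \<open>p\<close> inside, respectively outside, the block.\<close>

lemma closed_block_second_moment:
  assumes L: "L \<subseteq> I" and sepL: "\<And>q. q \<in> I - L \<Longrightarrow> Q p q = 0" and p: "p \<in> I"
  shows "(\<lambda>\<epsilon>. (\<integral>\<omega>. W \<epsilon> p \<omega> * (\<Sum>q\<in>L. x \<epsilon> q * W \<epsilon> q \<omega>) \<partial>M \<epsilon>) - a p * \<epsilon>) \<in> bigO 2"
proof -
  have "(\<lambda>\<epsilon>. (\<integral>\<omega>. W \<epsilon> p \<omega> * (\<Sum>q\<in>L. x \<epsilon> q * W \<epsilon> q \<omega>) \<partial>M \<epsilon>) - (\<Sum>q\<in>L. Q p q * x \<epsilon> q)) \<in> bigO 2"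
    using second_moment_form[OF p L, where x = x and k = 1] optimum_bigO[OF joint_opt] L
    by (auto simp: numeral_2_eq_2)
  moreover have "(\<lambda>\<epsilon>. \<Sum>q\<in>L. Q p q * (x \<epsilon> q - \<alpha> q * \<epsilon>)) \<in> bigO 2"
    using L by (intro big_sum_in_bigo bigO_cmult optimum_first_approx[OF joint_opt]) auto
  ultimately have "(\<lambda>\<epsilon>. (\<integral>\<omega>. W \<epsilon> p \<omega> * (\<Sum>q\<in>L. x \<epsilon> q * W \<epsilon> q \<omega>) \<partial>M \<epsilon>) - (\<Sum>q\<in>L. Q p q * x \<epsilon> q)
      + (\<Sum>q\<in>L. Q p q * (x \<epsilon> q - \<alpha> q * \<epsilon>))) \<in> bigO 2"
    by (rule bigO_add)
  moreover have "(\<Sum>q\<in>L. Q p q * (x \<epsilon> q - \<alpha> q * \<epsilon>)) = (\<Sum>q\<in>L. Q p q * x \<epsilon> q) - a p * \<epsilon>" for \<epsilon>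
  proof -
    have "(\<Sum>q\<in>L. Q p q * \<alpha> q) = (\<Sum>q\<in>I. Q p q * \<alpha> q)"
      using fin L sepL by (intro sum.mono_neutral_left) auto
    then have "(\<Sum>q\<in>L. Q p q * \<alpha> q) * \<epsilon> = a p * \<epsilon>" using Q_alpha[OF p] by simp
    then show ?thesis
      by (simp add: right_diff_distrib sum_subtractf sum_distrib_right mult.assoc)
  qed
  ultimately show ?thesis by simp
qed

lemma rest_sep: "p \<in> I - K \<Longrightarrow> q \<in> K \<Longrightarrow> Q p q = 0"
  using sep[of q p] Q_sym[of p q] K by auto

lemma Lambda_monomial: "(\<Sum>p\<in>I - K. (\<alpha> p * \<epsilon>) * (a p * \<epsilon>)) = \<Lambda> * \<epsilon> ^ 2"
  unfolding \<Lambda>_def by (simp add: sum_distrib_left power2_eq_square mult_ac)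

text \<open>The first and the second moment of \<open>w\<close> have the same leading term, because
\<open>\<Sum>p. \<alpha> p * (\<Sum>q. Q p q * \<alpha> q)\<close> equals \<open>\<Sum>p. \<alpha> p * a p\<close> over the remaining coordinates.\<close>

lemma rest_mean: "(\<lambda>\<epsilon>. (\<integral>\<omega>. w \<epsilon> \<omega> \<partial>M \<epsilon>) - \<Lambda> * \<epsilon> ^ 2) \<in> bigO 3"
proof (rule bigO_cong)
  have "\<forall>\<^sub>F \<epsilon> in at_right 0. \<forall>p\<in>I - K. integrable (M \<epsilon>) (W \<epsilon> p)"
    using fin by (intro eventually_ball_finite ballI random_bigO_integrable[OF prob W_random_bigO]) auto
  then show "\<forall>\<^sub>F \<epsilon> in at_right 0. (\<integral>\<omega>. w \<epsilon> \<omega> \<partial>M \<epsilon>) - \<Lambda> * \<epsilon> ^ 2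
      = (\<Sum>p\<in>I - K. x \<epsilon> p * (\<integral>\<omega>. W \<epsilon> p \<omega> \<partial>M \<epsilon>) - (\<alpha> p * \<epsilon>) * (a p * \<epsilon>))"
    by eventually_elim
      (simp add: w_def Bochner_Integration.integral_sum sum_subtractf Lambda_monomial)
  show "(\<lambda>\<epsilon>. \<Sum>p\<in>I - K. x \<epsilon> p * (\<integral>\<omega>. W \<epsilon> p \<omega> \<partial>M \<epsilon>) - (\<alpha> p * \<epsilon>) * (a p * \<epsilon>)) \<in> bigO 3"
  proof (rule big_sum_in_bigo)
    fix p assume "p \<in> I - K"
    then have p: "p \<in> I" by auto
    have "(\<lambda>\<epsilon>. x \<epsilon> p * (\<integral>\<omega>. W \<epsilon> p \<omega> \<partial>M \<epsilon>) - (\<alpha> p * \<epsilon>) * (a p * \<epsilon>)) \<in> bigO (1 + 1 + 1)"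
    proof (rule bigO_product_approx[OF optimum_bigO[OF joint_opt p]])
      show "(\<lambda>\<epsilon>. x \<epsilon> p - \<alpha> p * \<epsilon>) \<in> bigO (1 + 1)"
        using optimum_first_approx[OF joint_opt p] by (simp add: numeral_2_eq_2)
      show "(\<lambda>\<epsilon>. a p * \<epsilon>) \<in> bigO 1" using bigO_monomial[of "a p" 1] by simp
      show "(\<lambda>\<epsilon>. (\<integral>\<omega>. W \<epsilon> p \<omega> \<partial>M \<epsilon>) - a p * \<epsilon>) \<in> bigO (1 + 1)"
        using mean[OF p] by (simp add: numeral_2_eq_2)
    qed
    then show "(\<lambda>\<epsilon>. x \<epsilon> p * (\<integral>\<omega>. W \<epsilon> p \<omega> \<partial>M \<epsilon>) - (\<alpha> p * \<epsilon>) * (a p * \<epsilon>)) \<in> bigO 3"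
      by (simp add: numeral_3_eq_3)
  qed
qed

lemma rest_second_moment: "(\<lambda>\<epsilon>. (\<integral>\<omega>. w \<epsilon> \<omega> ^ 2 \<partial>M \<epsilon>) - \<Lambda> * \<epsilon> ^ 2) \<in> bigO 3"
proof (rule bigO_cong)
  have "\<forall>\<^sub>F \<epsilon> in at_right 0. \<forall>p\<in>I - K. integrable (M \<epsilon>) (\<lambda>\<omega>. W \<epsilon> p \<omega> * w \<epsilon> \<omega>)"
    using fin
    by (intro eventually_ball_finite ballI
        random_bigO_integrable[OF prob random_bigO_mult[OF W_random_bigO w_bigO]]) auto
  then show "\<forall>\<^sub>F \<epsilon> in at_right 0. (\<integral>\<omega>. w \<epsilon> \<omega> ^ 2 \<partial>M \<epsilon>) - \<Lambda> * \<epsilon> ^ 2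
      = (\<Sum>p\<in>I - K. x \<epsilon> p * (\<integral>\<omega>. W \<epsilon> p \<omega> * w \<epsilon> \<omega> \<partial>M \<epsilon>) - (\<alpha> p * \<epsilon>) * (a p * \<epsilon>))"
  proof eventually_elim
    case (elim \<epsilon>)
    have "w \<epsilon> \<omega> ^ 2 = (\<Sum>p\<in>I - K. x \<epsilon> p * (W \<epsilon> p \<omega> * w \<epsilon> \<omega>))" for \<omega>
      unfolding power2_eq_square by (subst w_def) (simp add: sum_distrib_right mult.assoc)
    then show ?case
      using elim
      by (simp add: Bochner_Integration.integral_sum sum_subtractf Lambda_monomial)
  qed
  show "(\<lambda>\<epsilon>. \<Sum>p\<in>I - K. x \<epsilon> p * (\<integral>\<omega>. W \<epsilon> p \<omega> * w \<epsilon> \<omega> \<partial>M \<epsilon>) - (\<alpha> p * \<epsilon>) * (a p * \<epsilon>)) \<in> bigO 3"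
  proof (rule big_sum_in_bigo)
    fix p assume pK: "p \<in> I - K"
    then have p: "p \<in> I" by auto
    have "(\<lambda>\<epsilon>. x \<epsilon> p * (\<integral>\<omega>. W \<epsilon> p \<omega> * w \<epsilon> \<omega> \<partial>M \<epsilon>) - (\<alpha> p * \<epsilon>) * (a p * \<epsilon>)) \<in> bigO (1 + 1 + 1)"
    proof (rule bigO_product_approx[OF optimum_bigO[OF joint_opt p]])
      show "(\<lambda>\<epsilon>. x \<epsilon> p - \<alpha> p * \<epsilon>) \<in> bigO (1 + 1)"
        using optimum_first_approx[OF joint_opt p] by (simp add: numeral_2_eq_2)
      show "(\<lambda>\<epsilon>. a p * \<epsilon>) \<in> bigO 1" using bigO_monomial[of "a p" 1] by simp
      show "(\<lambda>\<epsilon>. (\<integral>\<omega>. W \<epsilon> p \<omega> * w \<epsilon> \<omega> \<partial>M \<epsilon>) - a p * \<epsilon>) \<in> bigO (1 + 1)"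
        using closed_block_second_moment[of "I - K" p] rest_sep[OF pK] p
        by (simp add: numeral_2_eq_2 w_def)
    qed
    then show "(\<lambda>\<epsilon>. x \<epsilon> p * (\<integral>\<omega>. W \<epsilon> p \<omega> * w \<epsilon> \<omega> \<partial>M \<epsilon>) - (\<alpha> p * \<epsilon>) * (a p * \<epsilon>)) \<in> bigO 3"
      by (simp add: numeral_3_eq_3)
  qed
qed

text \<open>Since \<open>v ^ n = 1 - n * u + O(\<epsilon>\<^sup>2)\<close>, the integral is \<open>E[W p] - n * E[W p * u]\<close> up to second order,
and both terms have leading part \<open>a p * \<epsilon>\<close>.\<close>

lemma block_discounted_mean:
  assumes p: "p \<in> K"
  shows "(\<lambda>\<epsilon>. (\<integral>\<omega>. W \<epsilon> p \<omega> * v \<epsilon> \<omega> ^ n \<partial>M \<epsilon>) - (1 - real n) * a p * \<epsilon>) \<in> bigO 2"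
proof -
  have pI: "p \<in> I" using p K by auto
  define r where "r \<epsilon> \<omega> = W \<epsilon> p \<omega> * ((1 / (1 + u \<epsilon> \<omega>)) ^ n - 1 + real n * u \<epsilon> \<omega>)" for \<epsilon> \<omega>
  have r: "random_bigO M 2 r"
    using random_bigO_mult[OF W_random_bigO[OF pI] random_bigO_reciprocal_power_expansion[OF u_bigO, of n]]
    by (simp add: r_def[abs_def] numeral_2_eq_2)
  have expansion: "\<forall>\<^sub>F \<epsilon> in at_right 0.
      (\<integral>\<omega>. W \<epsilon> p \<omega> * v \<epsilon> \<omega> ^ n \<partial>M \<epsilon>) - (1 - real n) * a p * \<epsilon>
      = ((\<integral>\<omega>. W \<epsilon> p \<omega> \<partial>M \<epsilon>) - a p * \<epsilon>)
        - real n * ((\<integral>\<omega>. W \<epsilon> p \<omega> * u \<epsilon> \<omega> \<partial>M \<epsilon>) - a p * \<epsilon>) + (\<integral>\<omega>. r \<epsilon> \<omega> \<partial>M \<epsilon>)"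
    using random_bigO_integrable[OF prob r] random_bigO_integrable[OF prob W_random_bigO[OF pI]]
      random_bigO_integrable[OF prob random_bigO_mult[OF W_random_bigO[OF pI] u_bigO]]
  proof eventually_elim
    case (elim \<epsilon>)
    have "(\<integral>\<omega>. W \<epsilon> p \<omega> * v \<epsilon> \<omega> ^ n \<partial>M \<epsilon>)
        = (\<integral>\<omega>. W \<epsilon> p \<omega> - real n * (W \<epsilon> p \<omega> * u \<epsilon> \<omega>) + r \<epsilon> \<omega> \<partial>M \<epsilon>)"
      by (simp add: r_def v_def algebra_simps)
    also have "\<dots> = (\<integral>\<omega>. W \<epsilon> p \<omega> \<partial>M \<epsilon>) - real n * (\<integral>\<omega>. W \<epsilon> p \<omega> * u \<epsilon> \<omega> \<partial>M \<epsilon>) + (\<integral>\<omega>. r \<epsilon> \<omega> \<partial>M \<epsilon>)"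
      using elim by simp
    finally show ?case by (simp add: algebra_simps)
  qed
  have "(\<lambda>\<epsilon>. (\<integral>\<omega>. W \<epsilon> p \<omega> * u \<epsilon> \<omega> \<partial>M \<epsilon>) - a p * \<epsilon>) \<in> bigO 2"
    unfolding u_def using sep[OF p] K pI by (intro closed_block_second_moment) auto
  then show ?thesis
    by (intro bigO_cong[OF expansion]
        bigO_add[OF bigO_diff[OF mean[OF pI] bigO_cmult] random_bigO_integral[OF prob r]])
qed

lemma block_discounted_mean_bigO:
  assumes "p \<in> K"
  shows "(\<lambda>\<epsilon>. \<integral>\<omega>. W \<epsilon> p \<omega> * v \<epsilon> \<omega> ^ n \<partial>M \<epsilon>) \<in> bigO 1"
  using bigO_add[OF bigO_mono[OF block_discounted_mean[OF assms, of n], of 1]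
      bigO_monomial[of "(1 - real n) * a p" 1]] by simp

lemma rest_block_product:
  assumes p: "p \<in> K"
  shows "\<forall>\<^sub>F \<epsilon> in at_right 0. (\<integral>\<omega>. w \<epsilon> \<omega> ^ k * (W \<epsilon> p \<omega> * v \<epsilon> \<omega> ^ n) \<partial>M \<epsilon>)
    = (\<integral>\<omega>. w \<epsilon> \<omega> ^ k \<partial>M \<epsilon>) * (\<integral>\<omega>. W \<epsilon> p \<omega> * v \<epsilon> \<omega> ^ n \<partial>M \<epsilon>)"
  using prob indep random_bigO_integrable[OF prob w_power_bigO[of k]]
    random_bigO_integrable[OF prob W_v_bigO[OF subsetD[OF K p], of n]]
proof eventually_elim
  case (elim \<epsilon>)
  interpret prob_space "M \<epsilon>" by (rule elim)
  define f where "f z = z p * (1 / (1 + (\<Sum>q\<in>K. x \<epsilon> q * z q))) ^ n" for z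
  define g where "g z = (\<Sum>q\<in>I - K. x \<epsilon> q * z q) ^ k" for z
  have "indep_var borel (f \<circ> (\<lambda>\<omega>. \<lambda>p\<in>K. W \<epsilon> p \<omega>)) borel (g \<circ> (\<lambda>\<omega>. \<lambda>p\<in>I - K. W \<epsilon> p \<omega>))"
  proof (rule indep_var_compose[OF elim(2)])
    show "f \<in> borel_measurable (\<Pi>\<^sub>M p\<in>K. borel)"
      unfolding f_def[abs_def] using p by measurable
    show "g \<in> borel_measurable (\<Pi>\<^sub>M p\<in>I - K. borel)"
      unfolding g_def[abs_def] by measurable
  qed
  moreover have "f \<circ> (\<lambda>\<omega>. \<lambda>p\<in>K. W \<epsilon> p \<omega>) = (\<lambda>\<omega>. W \<epsilon> p \<omega> * v \<epsilon> \<omega> ^ n)"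
    using p by (simp add: fun_eq_iff f_def v_def u_def)
  moreover have "g \<circ> (\<lambda>\<omega>. \<lambda>p\<in>I - K. W \<epsilon> p \<omega>) = (\<lambda>\<omega>. w \<epsilon> \<omega> ^ k)"
    by (simp add: fun_eq_iff g_def w_def)
  ultimately have "indep_var borel (\<lambda>\<omega>. W \<epsilon> p \<omega> * v \<epsilon> \<omega> ^ n) borel (\<lambda>\<omega>. w \<epsilon> \<omega> ^ k)"
    by simp
  from indep_var_lebesgue_integral[OF this elim(4,3)] show ?case by (simp add: mult_ac)
qed

text \<open>Expand \<open>1 / (1 + u + w)\<close> in powers of \<open>w\<close> up to the third; the exact remainder carries \<open>w ^ 4\<close>.
After factorisation by independence, the coefficients \<open>1 - n\<close> at \<open>n = 2\<close> and \<open>n = 3\<close> combine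
as \<open>(-1) * (-1) + (-2) = -1\<close>, which leaves \<open>\<Lambda> * a p * \<epsilon> ^ 3\<close> for the gradient of the isolated
objective.  The cubic term is of order \<open>3 + 1\<close>.\<close>

lemma block_gradient_at_joint:
  assumes p: "p \<in> K"
  shows "(\<lambda>\<epsilon>. (\<integral>\<omega>. W \<epsilon> p \<omega> * v \<epsilon> \<omega> \<partial>M \<epsilon>) - \<Lambda> * a p * \<epsilon> ^ 3) \<in> bigO 4"
proof -
  have pI: "p \<in> I" using p K by auto
  define m where "m k \<epsilon> = (\<integral>\<omega>. w \<epsilon> \<omega> ^ k \<partial>M \<epsilon>)" for k \<epsilon>
  define b where "b n \<epsilon> = (\<integral>\<omega>. W \<epsilon> p \<omega> * v \<epsilon> \<omega> ^ n \<partial>M \<epsilon>)" for n \<epsilon>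
  define t where "t k \<epsilon> \<omega> = w \<epsilon> \<omega> ^ k * (W \<epsilon> p \<omega> * v \<epsilon> \<omega> ^ (k + 1))" for k \<epsilon> \<omega>
  define \<rho> where "\<rho> \<epsilon> \<omega> = w \<epsilon> \<omega> ^ 4 * (W \<epsilon> p \<omega> * v \<epsilon> \<omega> ^ 4 * (1 / (1 + (u \<epsilon> \<omega> + w \<epsilon> \<omega>))) ^ 1)" for \<epsilon> \<omega>
  have t: "random_bigO M k (t k)" for k
    using random_bigO_mult[OF w_power_bigO[of k] W_v_bigO[OF pI, of "k + 1"]]
    by (simp only: t_def[abs_def] add_0_right)
  have \<rho>: "random_bigO M 4 \<rho>"
    using random_bigO_mult[OF w_power_bigO
        random_bigO_mult[OF W_v_bigO[OF pI] random_bigO_reciprocal_power[OF uw_bigO]], of 4 4 1]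
    by (simp add: \<rho>_def[abs_def])
  have m_bigO: "m k \<in> bigO k" for k
    unfolding m_def by (rule random_bigO_integral[OF prob w_power_bigO])
  have b_bigO: "b n \<in> bigO 1" for n
    unfolding b_def by (rule block_discounted_mean_bigO[OF p])
  have half: "\<forall>\<^sub>F \<epsilon> in at_right 0. AE \<omega> in M \<epsilon>. \<bar>u \<epsilon> \<omega>\<bar> \<le> 1 / 2"
    "\<forall>\<^sub>F \<epsilon> in at_right 0. AE \<omega> in M \<epsilon>. \<bar>u \<epsilon> \<omega> + w \<epsilon> \<omega>\<bar> \<le> 1 / 2"
    using random_bigO_half[of M 0] u_bigO uw_bigO by simp_all
  note int = random_bigO_integrable[OF prob t] random_bigO_integrable[OF prob \<rho>]
  have expansion: "\<forall>\<^sub>F \<epsilon> in at_right 0. b 1 \<epsilon> - \<Lambda> * a p * \<epsilon> ^ 3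
      = (m 1 \<epsilon> * b 2 \<epsilon> - (\<Lambda> * \<epsilon> ^ 2) * (- a p * \<epsilon>))
        - (m 2 \<epsilon> * b 3 \<epsilon> - (\<Lambda> * \<epsilon> ^ 2) * (- 2 * a p * \<epsilon>))
        + m 3 \<epsilon> * b 4 \<epsilon> - (\<integral>\<omega>. \<rho> \<epsilon> \<omega> \<partial>M \<epsilon>)"
    using optimum_first_order[OF joint_opt] half int(1)[of 0] int(1)[of 1] int(1)[of 2] int(1)[of 3] int(2)
      rest_block_product[OF p, of 1 2] rest_block_product[OF p, of 2 3] rest_block_product[OF p, of 3 4]
      random_bigO_measurable[OF u_bigO] random_bigO_measurable[OF w_bigO] meas[OF pI]
  proof eventually_elim
    case (elim \<epsilon>)
    have [measurable]: "u \<epsilon> \<in> borel_measurable (M \<epsilon>)" "w \<epsilon> \<in> borel_measurable (M \<epsilon>)"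
      "W \<epsilon> p \<in> borel_measurable (M \<epsilon>)" using elim by auto
    have "0 = (\<integral>\<omega>. W \<epsilon> p \<omega> / (1 + (u \<epsilon> \<omega> + w \<epsilon> \<omega>)) \<partial>M \<epsilon>)"
      using elim(1) pI by (simp add: joint_split)
    also have "\<dots> = (\<integral>\<omega>. t 0 \<epsilon> \<omega> - t 1 \<epsilon> \<omega> + t 2 \<epsilon> \<omega> - t 3 \<epsilon> \<omega> + \<rho> \<epsilon> \<omega> \<partial>M \<epsilon>)"
    proof (rule integral_cong_AE)
      show "AE \<omega> in M \<epsilon>. W \<epsilon> p \<omega> / (1 + (u \<epsilon> \<omega> + w \<epsilon> \<omega>))
          = t 0 \<epsilon> \<omega> - t 1 \<epsilon> \<omega> + t 2 \<epsilon> \<omega> - t 3 \<epsilon> \<omega> + \<rho> \<epsilon> \<omega>"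
        using elim(2,3)
      proof eventually_elim
        case (elim \<omega>)
        define s where "s = 1 / (1 + (u \<epsilon> \<omega> + w \<epsilon> \<omega>))"
        have "1 + u \<epsilon> \<omega> \<noteq> 0" "1 + (u \<epsilon> \<omega> + w \<epsilon> \<omega>) \<noteq> 0" using elim by auto
        then have "v \<epsilon> \<omega> * ((1 + (u \<epsilon> \<omega> + w \<epsilon> \<omega>)) * s) = v \<epsilon> \<omega>" "s * (v \<epsilon> \<omega> * (1 + u \<epsilon> \<omega>)) = s"
          by (simp_all add: s_def v_def)
        then have "s = v \<epsilon> \<omega> - w \<epsilon> \<omega> * v \<epsilon> \<omega> * s"
          by (simp add: algebra_simps)
        \<comment> \<open>Iterating the fixed-point equation four times produces the truncated geometric series with its exact remainder.\<close>
        then have "s = v \<epsilon> \<omega> - w \<epsilon> \<omega> * v \<epsilon> \<omega> * (v \<epsilon> \<omega> - w \<epsilon> \<omega> * v \<epsilon> \<omega> *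
            (v \<epsilon> \<omega> - w \<epsilon> \<omega> * v \<epsilon> \<omega> * (v \<epsilon> \<omega> - w \<epsilon> \<omega> * v \<epsilon> \<omega> * s)))"
          by metis
        then have "W \<epsilon> p \<omega> * s = W \<epsilon> p \<omega> * (v \<epsilon> \<omega> - w \<epsilon> \<omega> * v \<epsilon> \<omega> * (v \<epsilon> \<omega> - w \<epsilon> \<omega> * v \<epsilon> \<omega> *
            (v \<epsilon> \<omega> - w \<epsilon> \<omega> * v \<epsilon> \<omega> * (v \<epsilon> \<omega> - w \<epsilon> \<omega> * v \<epsilon> \<omega> * s))))"
          by (rule arg_cong)
        also have "\<dots> = t 0 \<epsilon> \<omega> - t 1 \<epsilon> \<omega> + t 2 \<epsilon> \<omega> - t 3 \<epsilon> \<omega> + \<rho> \<epsilon> \<omega>"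
          unfolding t_def \<rho>_def s_def[symmetric]
          by (simp add: algebra_simps power2_eq_square power3_eq_cube power4_eq_xxxx)
        finally show ?case by (simp add: s_def)
      qed
    qed (simp_all add: t_def \<rho>_def v_def)
    also have "\<dots> = (\<integral>\<omega>. t 0 \<epsilon> \<omega> \<partial>M \<epsilon>) - (\<integral>\<omega>. t 1 \<epsilon> \<omega> \<partial>M \<epsilon>) + (\<integral>\<omega>. t 2 \<epsilon> \<omega> \<partial>M \<epsilon>)
        - (\<integral>\<omega>. t 3 \<epsilon> \<omega> \<partial>M \<epsilon>) + (\<integral>\<omega>. \<rho> \<epsilon> \<omega> \<partial>M \<epsilon>)"
      using elim by simp
    also have "(\<integral>\<omega>. t 0 \<epsilon> \<omega> \<partial>M \<epsilon>) = b 1 \<epsilon>" by (simp add: t_def b_def)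
    also have "(\<integral>\<omega>. t 1 \<epsilon> \<omega> \<partial>M \<epsilon>) = m 1 \<epsilon> * b 2 \<epsilon>"
      using elim(9) by (simp add: t_def b_def m_def numeral_2_eq_2)
    also have "(\<integral>\<omega>. t 2 \<epsilon> \<omega> \<partial>M \<epsilon>) = m 2 \<epsilon> * b 3 \<epsilon>"
      using elim(10) by (simp add: t_def b_def m_def)
    also have "(\<integral>\<omega>. t 3 \<epsilon> \<omega> \<partial>M \<epsilon>) = m 3 \<epsilon> * b 4 \<epsilon>"
      using elim(11) by (simp add: t_def b_def m_def)
    finally show ?case by (simp add: algebra_simps power2_eq_square power3_eq_cube)
  qed
  have lin: "(\<lambda>\<epsilon>. c * \<epsilon>) \<in> bigO 1" for c using bigO_monomial[of c 1] by simp
  have 1: "(\<lambda>\<epsilon>. m 1 \<epsilon> * b 2 \<epsilon> - (\<Lambda> * \<epsilon> ^ 2) * (- a p * \<epsilon>)) \<in> bigO (2 + 1 + 1)"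
  proof (rule bigO_product_approx[OF _ _ lin])
    show "(\<lambda>\<epsilon>. m 1 \<epsilon> - \<Lambda> * \<epsilon> ^ 2) \<in> bigO (2 + 1)" using rest_mean by (simp add: m_def)
    show "m 1 \<in> bigO 2"
      using bigO_add[OF bigO_mono[OF rest_mean, of 2] bigO_monomial[of \<Lambda> 2]] by (simp add: m_def[abs_def])
    show "(\<lambda>\<epsilon>. b 2 \<epsilon> - - a p * \<epsilon>) \<in> bigO (1 + 1)"
      using block_discounted_mean[OF p, of 2] by (simp add: b_def numeral_2_eq_2)
  qed
  have 2: "(\<lambda>\<epsilon>. m 2 \<epsilon> * b 3 \<epsilon> - (\<Lambda> * \<epsilon> ^ 2) * (- 2 * a p * \<epsilon>)) \<in> bigO (2 + 1 + 1)"
  proof (rule bigO_product_approx[OF m_bigO _ lin])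
    show "(\<lambda>\<epsilon>. m 2 \<epsilon> - \<Lambda> * \<epsilon> ^ 2) \<in> bigO (2 + 1)" using rest_second_moment by (simp add: m_def)
    show "(\<lambda>\<epsilon>. b 3 \<epsilon> - - 2 * a p * \<epsilon>) \<in> bigO (1 + 1)"
      unfolding one_add_one using block_discounted_mean[OF p, of 3] by (simp add: b_def)
  qed
  have 3: "(\<lambda>\<epsilon>. m 3 \<epsilon> * b 4 \<epsilon>) \<in> bigO (3 + 1)"
    by (rule bigO_mult[OF m_bigO b_bigO])
  have four: "(2 + 1 + 1 :: nat) = 4" "(3 + 1 :: nat) = 4" by simp_all
  have "(\<lambda>\<epsilon>. b 1 \<epsilon> - \<Lambda> * a p * \<epsilon> ^ 3) \<in> bigO 4"
    by (rule bigO_cong[OF expansion]) (intro bigO_add bigO_diff 1[unfolded four] 2[unfolded four]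
        3[unfolded four] random_bigO_integral[OF prob \<rho>])
  then show ?thesis by (simp add: b_def)
qed

lemma perturbed_second_moment:
  assumes p: "p \<in> K" and q: "q \<in> K"
  shows "(\<lambda>\<epsilon>. (\<integral>\<omega>. W \<epsilon> p \<omega> * W \<epsilon> q \<omega> * (v \<epsilon> \<omega> * v' \<epsilon> \<omega>) \<partial>M \<epsilon>) - Q p q) \<in> bigO 1"
proof -
  have pq: "p \<in> I" "q \<in> I" using p q K by auto
  define r where "r \<epsilon> \<omega> = W \<epsilon> p \<omega> * W \<epsilon> q \<omega> * (u \<epsilon> \<omega> * (v \<epsilon> \<omega> * v' \<epsilon> \<omega>) + u' \<epsilon> \<omega> * v' \<epsilon> \<omega>)" for \<epsilon> \<omega>
  have WW: "random_bigO M 0 (\<lambda>\<epsilon> \<omega>. W \<epsilon> p \<omega> * W \<epsilon> q \<omega>)"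
    using random_bigO_mult[OF W_random_bigO[OF pq(1)] W_random_bigO[OF pq(2)]] by simp
  have vv: "random_bigO M 0 (\<lambda>\<epsilon> \<omega>. v \<epsilon> \<omega> * v' \<epsilon> \<omega>)"
    using random_bigO_mult[OF v_bigO v'_bigO] by simp
  have "random_bigO M 1 (\<lambda>\<epsilon> \<omega>. u \<epsilon> \<omega> * (v \<epsilon> \<omega> * v' \<epsilon> \<omega>) + u' \<epsilon> \<omega> * v' \<epsilon> \<omega>)"
    using random_bigO_mult[OF u_bigO vv] random_bigO_mult[OF u'_bigO v'_bigO]
    by (intro random_bigO_add) simp_all
  from random_bigO_mult[OF WW this] have r: "random_bigO M 1 r"
    by (simp add: r_def[abs_def])
  have WWvv: "random_bigO M 0 (\<lambda>\<epsilon> \<omega>. W \<epsilon> p \<omega> * W \<epsilon> q \<omega> * (v \<epsilon> \<omega> * v' \<epsilon> \<omega>))"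
    using random_bigO_mult[OF WW vv] by simp
  have half: "\<forall>\<^sub>F \<epsilon> in at_right 0. AE \<omega> in M \<epsilon>. \<bar>u \<epsilon> \<omega>\<bar> \<le> 1 / 2"
    "\<forall>\<^sub>F \<epsilon> in at_right 0. AE \<omega> in M \<epsilon>. \<bar>u' \<epsilon> \<omega>\<bar> \<le> 1 / 2"
    using random_bigO_half[of M 0] u_bigO u'_bigO by simp_all
  have "\<forall>\<^sub>F \<epsilon> in at_right 0. (\<integral>\<omega>. W \<epsilon> p \<omega> * W \<epsilon> q \<omega> * (v \<epsilon> \<omega> * v' \<epsilon> \<omega>) \<partial>M \<epsilon>) - Q p q
      = ((\<integral>\<omega>. W \<epsilon> p \<omega> * W \<epsilon> q \<omega> \<partial>M \<epsilon>) - Q p q) - (\<integral>\<omega>. r \<epsilon> \<omega> \<partial>M \<epsilon>)"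
    using half random_bigO_integrable[OF prob r] random_bigO_integrable[OF prob WW]
      random_bigO_measurable[OF WWvv]
  proof eventually_elim
    case (elim \<epsilon>)
    have "(\<integral>\<omega>. W \<epsilon> p \<omega> * W \<epsilon> q \<omega> * (v \<epsilon> \<omega> * v' \<epsilon> \<omega>) \<partial>M \<epsilon>)
        = (\<integral>\<omega>. W \<epsilon> p \<omega> * W \<epsilon> q \<omega> - r \<epsilon> \<omega> \<partial>M \<epsilon>)"
    proof (rule integral_cong_AE)
      show "(\<lambda>\<omega>. W \<epsilon> p \<omega> * W \<epsilon> q \<omega> * (v \<epsilon> \<omega> * v' \<epsilon> \<omega>)) \<in> borel_measurable (M \<epsilon>)" by (rule elim)
      show "(\<lambda>\<omega>. W \<epsilon> p \<omega> * W \<epsilon> q \<omega> - r \<epsilon> \<omega>) \<in> borel_measurable (M \<epsilon>)"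
        using elim(3,4) by (intro borel_measurable_diff borel_measurable_integrable)
      show "AE \<omega> in M \<epsilon>. W \<epsilon> p \<omega> * W \<epsilon> q \<omega> * (v \<epsilon> \<omega> * v' \<epsilon> \<omega>) = W \<epsilon> p \<omega> * W \<epsilon> q \<omega> - r \<epsilon> \<omega>"
        using elim(1,2)
      proof eventually_elim
        case (elim \<omega>)
        have "1 + u \<epsilon> \<omega> \<noteq> 0" "1 + u' \<epsilon> \<omega> \<noteq> 0" using elim by auto
        then have "v' \<epsilon> \<omega> * (v \<epsilon> \<omega> * (1 + u \<epsilon> \<omega>)) = v' \<epsilon> \<omega>" "v' \<epsilon> \<omega> * (1 + u' \<epsilon> \<omega>) = 1"
          by (simp_all add: v_def v'_def)
        then have "v \<epsilon> \<omega> * v' \<epsilon> \<omega> = 1 - (u \<epsilon> \<omega> * (v \<epsilon> \<omega> * v' \<epsilon> \<omega>) + u' \<epsilon> \<omega> * v' \<epsilon> \<omega>)"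
          by (simp add: algebra_simps)
        then show ?case unfolding r_def by (metis mult.right_neutral right_diff_distrib)
      qed
    qed
    then show ?case using elim by simp
  qed
  then show ?thesis
    by (rule bigO_cong) (intro bigO_diff second_moment pq random_bigO_integral[OF prob r])
qed

text \<open>The gradient vanishes at the isolated optimum, and
\<open>v - v' = - (u - u') * v * v'\<close> is linear in the difference of the stakes.\<close>

lemma gradient_difference:
  assumes p: "p \<in> K"
  shows "\<forall>\<^sub>F \<epsilon> in at_right 0. (\<integral>\<omega>. W \<epsilon> p \<omega> * v \<epsilon> \<omega> \<partial>M \<epsilon>)
    = - (\<Sum>q\<in>K. (\<integral>\<omega>. W \<epsilon> p \<omega> * W \<epsilon> q \<omega> * (v \<epsilon> \<omega> * v' \<epsilon> \<omega>) \<partial>M \<epsilon>) * (x \<epsilon> q - y \<epsilon> q))"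
proof -
  have pI: "p \<in> I" using p K by auto
  have half: "\<forall>\<^sub>F \<epsilon> in at_right 0. AE \<omega> in M \<epsilon>. \<bar>u \<epsilon> \<omega>\<bar> \<le> 1 / 2"
    "\<forall>\<^sub>F \<epsilon> in at_right 0. AE \<omega> in M \<epsilon>. \<bar>u' \<epsilon> \<omega>\<bar> \<le> 1 / 2"
    using random_bigO_half[of M 0] u_bigO u'_bigO by simp_all
  have vv: "random_bigO M 0 (\<lambda>\<epsilon> \<omega>. v \<epsilon> \<omega> * v' \<epsilon> \<omega>)"
    using random_bigO_mult[OF v_bigO v'_bigO] by simp
  have "random_bigO M 0 (\<lambda>\<epsilon> \<omega>. W \<epsilon> p \<omega> * W \<epsilon> q \<omega> * (v \<epsilon> \<omega> * v' \<epsilon> \<omega>))" if "q \<in> K" for q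
    using random_bigO_mult[OF random_bigO_mult[OF W_random_bigO[OF pI] W_random_bigO, simplified] vv] that K
    by auto
  then have int: "\<forall>\<^sub>F \<epsilon> in at_right 0. \<forall>q\<in>K.
      integrable (M \<epsilon>) (\<lambda>\<omega>. W \<epsilon> p \<omega> * W \<epsilon> q \<omega> * (v \<epsilon> \<omega> * v' \<epsilon> \<omega>))"
    using K.fin by (intro eventually_ball_finite ballI random_bigO_integrable[OF prob])
  have Wv: "random_bigO M 0 (\<lambda>\<epsilon> \<omega>. W \<epsilon> p \<omega> * v \<epsilon> \<omega>)"
    using W_v_bigO[OF pI, of 1] by simp
  have Wv': "random_bigO M 0 (\<lambda>\<epsilon> \<omega>. W \<epsilon> p \<omega> * v' \<epsilon> \<omega>)"
    using random_bigO_mult[OF W_random_bigO[OF pI] v'_bigO] by simp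
  show ?thesis
    using half int K.optimum_first_order[OF block_opt]
      random_bigO_integrable[OF prob Wv] random_bigO_integrable[OF prob Wv']
  proof eventually_elim
    case (elim \<epsilon>)
    have int: "integrable (M \<epsilon>) (\<lambda>\<omega>. \<Sum>q\<in>K. (x \<epsilon> q - y \<epsilon> q) * (W \<epsilon> p \<omega> * W \<epsilon> q \<omega> * (v \<epsilon> \<omega> * v' \<epsilon> \<omega>)))"
      using elim(3) by (intro Bochner_Integration.integrable_sum integrable_mult_right) auto
    have "(\<integral>\<omega>. W \<epsilon> p \<omega> * v \<epsilon> \<omega> \<partial>M \<epsilon>) = (\<integral>\<omega>. W \<epsilon> p \<omega> * v' \<epsilon> \<omega> -
        (\<Sum>q\<in>K. (x \<epsilon> q - y \<epsilon> q) * (W \<epsilon> p \<omega> * W \<epsilon> q \<omega> * (v \<epsilon> \<omega> * v' \<epsilon> \<omega>))) \<partial>M \<epsilon>)"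
    proof (rule integral_cong_AE)
      show "(\<lambda>\<omega>. W \<epsilon> p \<omega> * v \<epsilon> \<omega>) \<in> borel_measurable (M \<epsilon>)"
        using elim by (intro borel_measurable_integrable)
      show "(\<lambda>\<omega>. W \<epsilon> p \<omega> * v' \<epsilon> \<omega> - (\<Sum>q\<in>K. (x \<epsilon> q - y \<epsilon> q) *
          (W \<epsilon> p \<omega> * W \<epsilon> q \<omega> * (v \<epsilon> \<omega> * v' \<epsilon> \<omega>)))) \<in> borel_measurable (M \<epsilon>)"
        using elim int by (intro borel_measurable_integrable Bochner_Integration.integrable_diff)
      show "AE \<omega> in M \<epsilon>. W \<epsilon> p \<omega> * v \<epsilon> \<omega> = W \<epsilon> p \<omega> * v' \<epsilon> \<omega> -
          (\<Sum>q\<in>K. (x \<epsilon> q - y \<epsilon> q) * (W \<epsilon> p \<omega> * W \<epsilon> q \<omega> * (v \<epsilon> \<omega> * v' \<epsilon> \<omega>)))"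
        using elim(1,2)
      proof eventually_elim
        case (elim \<omega>)
        have "1 + u \<epsilon> \<omega> \<noteq> 0" "1 + u' \<epsilon> \<omega> \<noteq> 0" using elim by auto
        then have e: "v \<epsilon> \<omega> * (1 + u \<epsilon> \<omega>) = 1" "v' \<epsilon> \<omega> * (1 + u' \<epsilon> \<omega>) = 1"
          by (simp_all add: v_def v'_def)
        have "v \<epsilon> \<omega> = v \<epsilon> \<omega> * (v' \<epsilon> \<omega> * (1 + u' \<epsilon> \<omega>))"
          by (simp add: e)
        also have "\<dots> = v' \<epsilon> \<omega> * (v \<epsilon> \<omega> * (1 + u \<epsilon> \<omega>)) - (u \<epsilon> \<omega> - u' \<epsilon> \<omega>) * (v \<epsilon> \<omega> * v' \<epsilon> \<omega>)"
          by (simp add: algebra_simps)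
        finally have "v \<epsilon> \<omega> = v' \<epsilon> \<omega> - (u \<epsilon> \<omega> - u' \<epsilon> \<omega>) * (v \<epsilon> \<omega> * v' \<epsilon> \<omega>)"
          by (simp add: e)
        then have "W \<epsilon> p \<omega> * v \<epsilon> \<omega> = W \<epsilon> p \<omega> * v' \<epsilon> \<omega> - W \<epsilon> p \<omega> * (u \<epsilon> \<omega> - u' \<epsilon> \<omega>) * (v \<epsilon> \<omega> * v' \<epsilon> \<omega>)"
          by (metis mult.assoc right_diff_distrib)
        also have "W \<epsilon> p \<omega> * (u \<epsilon> \<omega> - u' \<epsilon> \<omega>) * (v \<epsilon> \<omega> * v' \<epsilon> \<omega>) =
            (\<Sum>q\<in>K. (x \<epsilon> q - y \<epsilon> q) * (W \<epsilon> p \<omega> * W \<epsilon> q \<omega> * (v \<epsilon> \<omega> * v' \<epsilon> \<omega>)))"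
          unfolding u_def u'_def sum_subtractf[symmetric] sum_distrib_left sum_distrib_right
          by (intro sum.cong refl) (simp add: algebra_simps)
        finally show ?case .
      qed
    qed
    also have "\<dots> = (\<integral>\<omega>. W \<epsilon> p \<omega> * v' \<epsilon> \<omega> \<partial>M \<epsilon>) -
        (\<Sum>q\<in>K. (x \<epsilon> q - y \<epsilon> q) * (\<integral>\<omega>. W \<epsilon> p \<omega> * W \<epsilon> q \<omega> * (v \<epsilon> \<omega> * v' \<epsilon> \<omega>) \<partial>M \<epsilon>))"
      using elim(3,6) int by (simp add: Bochner_Integration.integral_sum)
    also have "(\<integral>\<omega>. W \<epsilon> p \<omega> * v' \<epsilon> \<omega> \<partial>M \<epsilon>) = 0"
      using elim(4) p by (simp add: v'_def u'_def)
    finally show ?case by (simp add: mult.commute)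
  qed
qed

text \<open>The matrix in the gradient difference is \<open>Q\<close> only up to \<open>O(\<epsilon>)\<close>.  If the stakes differ by
\<open>O(\<epsilon> ^ k)\<close>, replacing it by \<open>Q\<close> makes an error \<open>O(\<epsilon> ^ (k + 1))\<close>, and inverting \<open>Q\<close> keeps that order.  Starting from \<open>O(\<epsilon>)\<close>, three rounds reach \<open>O(\<epsilon> ^ 4)\<close>.\<close>

lemma stake_difference_bootstrap:
  assumes diff: "\<And>q. q \<in> K \<Longrightarrow> (\<lambda>\<epsilon>. x \<epsilon> q - y \<epsilon> q) \<in> bigO k" and k: "k \<le> 3" and r: "r \<in> K"
  shows "(\<lambda>\<epsilon>. x \<epsilon> r - y \<epsilon> r + \<Lambda> * \<alpha> r * \<epsilon> ^ 3) \<in> bigO (k + 1)"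
proof (rule K.solve_linear_bigO[OF _ r])
  fix p assume p: "p \<in> K"
  define H where "H q \<epsilon> = (\<integral>\<omega>. W \<epsilon> p \<omega> * W \<epsilon> q \<omega> * (v \<epsilon> \<omega> * v' \<epsilon> \<omega>) \<partial>M \<epsilon>)" for q \<epsilon>
  have "\<forall>\<^sub>F \<epsilon> in at_right 0. (\<Sum>q\<in>K. Q p q * (x \<epsilon> q - y \<epsilon> q + \<Lambda> * \<alpha> q * \<epsilon> ^ 3))
      = - ((\<integral>\<omega>. W \<epsilon> p \<omega> * v \<epsilon> \<omega> \<partial>M \<epsilon>) - \<Lambda> * a p * \<epsilon> ^ 3)
        - (\<Sum>q\<in>K. (H q \<epsilon> - Q p q) * (x \<epsilon> q - y \<epsilon> q))"
    using gradient_difference[OF p]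
  proof eventually_elim
    case (elim \<epsilon>)
    have "(\<Sum>q\<in>K. Q p q * (x \<epsilon> q - y \<epsilon> q + \<Lambda> * \<alpha> q * \<epsilon> ^ 3))
        = (\<Sum>q\<in>K. H q \<epsilon> * (x \<epsilon> q - y \<epsilon> q)) - (\<Sum>q\<in>K. (H q \<epsilon> - Q p q) * (x \<epsilon> q - y \<epsilon> q))
          + (\<Sum>q\<in>K. Q p q * \<alpha> q) * (\<Lambda> * \<epsilon> ^ 3)"
      unfolding sum_distrib_right sum_subtractf[symmetric] sum.distrib[symmetric]
      by (intro sum.cong refl) (simp add: algebra_simps)
    then show ?case using elim K.Q_alpha[OF p] by (simp add: H_def)
  qed
  moreover have "(\<lambda>\<epsilon>. - ((\<integral>\<omega>. W \<epsilon> p \<omega> * v \<epsilon> \<omega> \<partial>M \<epsilon>) - \<Lambda> * a p * \<epsilon> ^ 3)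
        - (\<Sum>q\<in>K. (H q \<epsilon> - Q p q) * (x \<epsilon> q - y \<epsilon> q))) \<in> bigO (k + 1)"
  proof (rule bigO_diff[OF bigO_uminus[OF bigO_mono[OF block_gradient_at_joint[OF p]]] big_sum_in_bigo])
    show "k + 1 \<le> 4" using k by simp
    fix q assume q: "q \<in> K"
    have "(\<lambda>\<epsilon>. (H q \<epsilon> - Q p q) * (x \<epsilon> q - y \<epsilon> q)) \<in> bigO (1 + k)"
      unfolding H_def by (rule bigO_mult[OF perturbed_second_moment[OF p q] diff[OF q]])
    then show "(\<lambda>\<epsilon>. (H q \<epsilon> - Q p q) * (x \<epsilon> q - y \<epsilon> q)) \<in> bigO (k + 1)"
      by (simp only: add.commute)
  qed
  ultimately show "(\<lambda>\<epsilon>. \<Sum>q\<in>K. Q p q * (x \<epsilon> q - y \<epsilon> q + \<Lambda> * \<alpha> q * \<epsilon> ^ 3)) \<in> bigO (k + 1)"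
    by (rule bigO_cong)
qed

lemma stake_difference_bigO:
  assumes q: "q \<in> K"
  shows "(\<lambda>\<epsilon>. x \<epsilon> q - y \<epsilon> q) \<in> bigO 3"
proof -
  have step: "(\<lambda>\<epsilon>. x \<epsilon> q - y \<epsilon> q) \<in> bigO (k + 1)"
    if "\<And>q. q \<in> K \<Longrightarrow> (\<lambda>\<epsilon>. x \<epsilon> q - y \<epsilon> q) \<in> bigO k" "k + 1 \<le> 3" "q \<in> K" for k q
  proof -
    have "(\<lambda>\<epsilon>. (x \<epsilon> q - y \<epsilon> q + \<Lambda> * \<alpha> q * \<epsilon> ^ 3) - \<Lambda> * \<alpha> q * \<epsilon> ^ 3) \<in> bigO (k + 1)"
      using that
      by (intro bigO_diff[OF stake_difference_bootstrap bigO_mono[OF bigO_monomial]]) auto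
    then show ?thesis by simp
  qed
  have 1: "(\<lambda>\<epsilon>. x \<epsilon> q - y \<epsilon> q) \<in> bigO 1" if "q \<in> K" for q
    using that K by (intro bigO_diff optimum_bigO[OF joint_opt] K.optimum_bigO[OF block_opt]) auto
  have 2: "(\<lambda>\<epsilon>. x \<epsilon> q - y \<epsilon> q) \<in> bigO 2" if "q \<in> K" for q
    using step[of 1, OF 1 _ that] by (simp add: numeral_2_eq_2)
  show ?thesis using step[of 2, OF 2 _ q] by simp
qed

theorem cubic_shrinkage:
  assumes "q \<in> K"
  shows "(\<lambda>\<epsilon>. x \<epsilon> q - y \<epsilon> q + \<Lambda> * \<alpha> q * \<epsilon> ^ 3) \<in> bigO 4"
  using stake_difference_bootstrap[OF stake_difference_bigO _ assms] by simp

end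

section \<open>From vector blocks to coordinates\<close>

definition coordinates :: "(nat \<Rightarrow> nat) \<Rightarrow> nat set \<Rightarrow> (nat \<times> nat) set" where
  "coordinates d J = (SIGMA j:J. {..<d j})"

definition entry :: "(nat \<Rightarrow> real vec) \<Rightarrow> nat \<times> nat \<Rightarrow> real" where
  "entry x p = x (fst p) $ snd p"

definition block_diagonal :: "(nat \<Rightarrow> real mat) \<Rightarrow> nat \<times> nat \<Rightarrow> nat \<times> nat \<Rightarrow> real" where
  "block_diagonal A p q = (if fst p = fst q then A (fst p) $$ (snd p, snd q) else 0)"

lemma finite_coordinates: "finite J \<Longrightarrow> finite (coordinates d J)"
  by (simp add: coordinates_def)

lemma coordinates_iff: "p \<in> coordinates d J \<longleftrightarrow> fst p \<in> J \<and> snd p < d (fst p)"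
  by (cases p) (simp add: coordinates_def)

lemma coordinates_diff: "coordinates d J - coordinates d A = coordinates d (J - A)"
  by (auto simp: coordinates_def)

lemma sum_coordinates:
  "finite J \<Longrightarrow> (\<Sum>p\<in>coordinates d J. f p) = (\<Sum>j\<in>J. \<Sum>i<d j. f (j, i))"
  by (simp add: coordinates_def sum.Sigma)

lemma sum_block_diagonal:
  assumes "finite J" "j \<in> J"
  shows "(\<Sum>q\<in>coordinates d J. block_diagonal A (j, i) q * f q) = (\<Sum>l<d j. A j $$ (i, l) * f (j, l))"
proof -
  have "(\<Sum>q\<in>coordinates d J. block_diagonal A (j, i) q * f q)
      = (\<Sum>k\<in>J. if j = k then (\<Sum>l<d k. A j $$ (i, l) * f (k, l)) else 0)"
    unfolding sum_coordinates[OF assms(1)] by (intro sum.cong refl) (simp add: block_diagonal_def)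
  then show ?thesis using assms by simp
qed

lemma ext_expectation_cong:
  "(\<And>\<omega>. \<omega> \<in> space M \<Longrightarrow> f \<omega> = g \<omega>) \<Longrightarrow> ext_expectation M f = ext_expectation M g"
  unfolding ext_expectation_def
  by (intro arg_cong2[where f = minus] arg_cong[where f = enn2ereal] nn_integral_cong) auto

lemma log_growth_coordinates:
  assumes J: "finite J" and X: "\<And>j. j \<in> J \<Longrightarrow> X j \<in> space M \<rightarrow> carrier_vec (d j)"
  shows "ext_expectation M (\<lambda>\<omega>. ext_ln (1 + (\<Sum>j\<in>J. y j \<bullet> X j \<omega>)))
    = log_growth M (coordinates d J) (\<lambda>p \<omega>. entry (\<lambda>j. X j \<omega>) p) (entry y)"
  unfolding log_growth_def
proof (rule ext_expectation_cong)
  fix \<omega> assume "\<omega> \<in> space M"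
  then have "dim_vec (X j \<omega>) = d j" if "j \<in> J" for j
    using X[OF that] by (auto dest: funcset_mem)
  then have "(\<Sum>j\<in>J. y j \<bullet> X j \<omega>) = (\<Sum>p\<in>coordinates d J. entry y p * entry (\<lambda>j. X j \<omega>) p)"
    unfolding sum_coordinates[OF J] by (simp add: scalar_prod_def entry_def lessThan_atLeast0)
  then show "ext_ln (1 + (\<Sum>j\<in>J. y j \<bullet> X j \<omega>))
      = ext_ln (1 + (\<Sum>p\<in>coordinates d J. entry y p * entry (\<lambda>j. X j \<omega>) p))" by simp
qed

lemma log_growth_cong:
  "(\<And>p. p \<in> I \<Longrightarrow> x p = y p) \<Longrightarrow> log_growth M I W x = log_growth M I W y"
  unfolding log_growth_def by (simp cong: sum.cong)

text \<open>Both optimisation problems of the theorem are covered: \<open>J\<close> is the set of all blocks for the joint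
problem and a singleton for the isolated one.\<close>

lemma interior_optimum_coordinates:
  assumes J: "finite J" and X: "\<And>j. j \<in> J \<Longrightarrow> X j \<in> space M \<rightarrow> carrier_vec (d j)"
    and pos: "\<And>j i. j \<in> J \<Longrightarrow> i < d j \<Longrightarrow> 0 < x j $ i"
    and max: "\<And>y. (\<And>j. j \<in> J \<Longrightarrow> y j \<in> stakes (d j)) \<Longrightarrow>
      ext_expectation M (\<lambda>\<omega>. ext_ln (1 + (\<Sum>j\<in>J. y j \<bullet> X j \<omega>)))
        \<le> ext_expectation M (\<lambda>\<omega>. ext_ln (1 + (\<Sum>j\<in>J. x j \<bullet> X j \<omega>)))"
  shows "interior_optimum M (coordinates d J) (\<lambda>p \<omega>. entry (\<lambda>j. X j \<omega>) p) (entry x)"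
  unfolding interior_optimum_def
proof (intro conjI allI impI)
  show "\<forall>p\<in>coordinates d J. 0 < entry x p"
    using pos by (auto simp: coordinates_def entry_def)
next
  fix z :: "nat \<times> nat \<Rightarrow> real" assume z: "\<forall>p\<in>coordinates d J. 0 \<le> z p"
  define y where "y j = vec (d j) (\<lambda>i. z (j, i))" for j
  have "log_growth M (coordinates d J) (\<lambda>p \<omega>. entry (\<lambda>j. X j \<omega>) p) z
      = log_growth M (coordinates d J) (\<lambda>p \<omega>. entry (\<lambda>j. X j \<omega>) p) (entry y)"
    by (rule log_growth_cong) (auto simp: y_def entry_def coordinates_def)
  also have "\<dots> \<le> log_growth M (coordinates d J) (\<lambda>p \<omega>. entry (\<lambda>j. X j \<omega>) p) (entry x)"
  proof -
    have "y j \<in> stakes (d j)" if "j \<in> J" for j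
      using z that by (auto simp: y_def stakes_def coordinates_iff)
    from max[of y, OF this] show ?thesis
      by (simp only: log_growth_coordinates[where M = M and J = J and X = X and d = d, OF J X])
  qed
  finally show "log_growth M (coordinates d J) (\<lambda>p \<omega>. entry (\<lambda>j. X j \<omega>) p) z
      \<le> log_growth M (coordinates d J) (\<lambda>p \<omega>. entry (\<lambda>j. X j \<omega>) p) (entry x)" .
qed

lemma (in prob_space) indep_var_coordinates:
  assumes ind: "indep_vars (\<lambda>j. borel_vec (d j)) X J" and AB: "A \<inter> B = {}" "A \<subseteq> J" "B \<subseteq> J"
  shows "indep_var (\<Pi>\<^sub>M p\<in>coordinates d A. borel) (\<lambda>\<omega>. \<lambda>p\<in>coordinates d A. entry (\<lambda>j. X j \<omega>) p)
    (\<Pi>\<^sub>M p\<in>coordinates d B. borel) (\<lambda>\<omega>. \<lambda>p\<in>coordinates d B. entry (\<lambda>j. X j \<omega>) p)"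
proof -
  define f where "f L z = (\<lambda>p\<in>coordinates d L. entry z p)" for L and z :: "nat \<Rightarrow> real vec"
  have f: "f L \<in> (\<Pi>\<^sub>M j\<in>L. borel_vec (d j)) \<rightarrow>\<^sub>M (\<Pi>\<^sub>M p\<in>coordinates d L. borel)" for L
    unfolding f_def[abs_def]
  proof (rule measurable_restrict)
    fix p assume p: "p \<in> coordinates d L"
    have "(\<lambda>v. v $ snd p) \<in> borel_measurable (borel_vec (d (fst p)))"
      using measurable_borel_vec_iff[THEN iffD1, OF measurable_ident_sets[OF refl], of "d (fst p)"] p
      by (auto simp: coordinates_def)
    moreover have "(\<lambda>z. z (fst p)) \<in> (\<Pi>\<^sub>M j\<in>L. borel_vec (d j)) \<rightarrow>\<^sub>M borel_vec (d (fst p))"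
      using p by (intro measurable_component_singleton) (auto simp: coordinates_def)
    ultimately have "(\<lambda>z. z (fst p) $ snd p) \<in> (\<Pi>\<^sub>M j\<in>L. borel_vec (d j)) \<rightarrow>\<^sub>M borel"
      by (rule measurable_compose[rotated])
    then show "(\<lambda>z. entry z p) \<in> (\<Pi>\<^sub>M j\<in>L. borel_vec (d j)) \<rightarrow>\<^sub>M borel"
      by (simp add: entry_def)
  qed
  have "f L \<circ> (\<lambda>\<omega>. \<lambda>j\<in>L. X j \<omega>) = (\<lambda>\<omega>. \<lambda>p\<in>coordinates d L. entry (\<lambda>j. X j \<omega>) p)" for L
    by (auto simp: fun_eq_iff f_def restrict_def entry_def coordinates_def)
  with indep_var_compose[OF indep_var_restrict[OF ind AB] f f] show ?thesis by simp
qed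

lemma Lambda_coordinates:
  assumes a: "\<And>j. j \<in> {1..m} \<Longrightarrow> a j \<in> carrier_vec (d j)"
    and C: "\<And>j. j \<in> {1..m} \<Longrightarrow> pos_def_mat (d j) (C j)"
  shows "Lambda m C a j = (\<Sum>p\<in>coordinates d ({1..m} - {j}). entry a p * entry (alpha C a) p)"
proof -
  have "a k \<bullet> (inv_mat (C k) *\<^sub>v a k) = (\<Sum>i<d k. a k $ i * alpha C a k $ i)" if "k \<in> {1..m}" for k
    using pos_def_mat_inverse(1)[OF C[OF that]]
    by (simp add: scalar_prod_def alpha_def lessThan_atLeast0)
  then show ?thesis
    by (simp add: Lambda_def sum_coordinates entry_def)
qed

text \<open>With \<open>\<alpha> = C\<^sup>-\<^sup>1 a\<close>, each summand \<open>a \<bullet> \<alpha>\<close> is the value \<open>\<alpha> \<bullet> C \<alpha>\<close> of a positive definite form.\<close>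

lemma Lambda_nonneg:
  assumes a: "\<And>j. j \<in> {1..m} \<Longrightarrow> a j \<in> carrier_vec (d j)"
    and C: "\<And>j. j \<in> {1..m} \<Longrightarrow> pos_def_mat (d j) (C j)"
  shows "0 \<le> Lambda m C a j"
proof -
  have "Lambda m C a j = (\<Sum>p\<in>coordinates d ({1..m} - {j}). entry a p * entry (alpha C a) p)"
    using a C by (rule Lambda_coordinates)
  also have "\<dots> = (\<Sum>k\<in>{1..m} - {j}. \<Sum>i<d k. entry a (k, i) * entry (alpha C a) (k, i))"
    by (rule sum_coordinates) simp
  also have "\<dots> \<ge> 0"
  proof (rule sum_nonneg)
    fix k assume "k \<in> {1..m} - {j}"
    then have k: "k \<in> {1..m}" by simp
    have "0 \<le> (\<Sum>i<d k. \<Sum>l<d k. alpha C a k $ i * C k $$ (i, l) * alpha C a k $ l)"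
      by (rule pos_def_mat_form_nonneg[OF C[OF k]])
    also have "\<dots> = (\<Sum>i<d k. alpha C a k $ i * (\<Sum>l<d k. C k $$ (i, l) * alpha C a k $ l))"
      by (simp add: sum_distrib_left mult.assoc)
    also have "\<dots> = (\<Sum>i<d k. alpha C a k $ i * a k $ i)"
      using pos_def_mat_mult_inverse_vec[OF C[OF k] a[OF k]] by (simp add: alpha_def)
    finally show "0 \<le> (\<Sum>i<d k. entry a (k, i) * entry (alpha C a) (k, i))"
      by (simp add: entry_def mult.commute)
  qed
  finally show ?thesis .
qed

theorem theorem4p2:
  fixes m :: nat
    and d :: "nat \<Rightarrow> nat"
    and \<epsilon>\<^sub>0 :: real
    and M :: "real \<Rightarrow> 'w measure"
    and Z :: "real \<Rightarrow> nat \<Rightarrow> 'w \<Rightarrow> real vec"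
    and a :: "nat \<Rightarrow> real vec"
    and C :: "nat \<Rightarrow> real mat"
    and x_ind x_sim :: "real \<Rightarrow> nat \<Rightarrow> real vec"
  assumes m: "1 \<le> m"
    and eps0: "0 < \<epsilon>\<^sub>0"
    and prob: "\<And>\<epsilon>. 0 < \<epsilon> \<Longrightarrow> \<epsilon> < \<epsilon>\<^sub>0 \<Longrightarrow> prob_space (M \<epsilon>)"
    and indep: "\<And>\<epsilon>. 0 < \<epsilon> \<Longrightarrow> \<epsilon> < \<epsilon>\<^sub>0 \<Longrightarrow>
          prob_space.indep_vars (M \<epsilon>) (\<lambda>j. borel_vec (d j)) (Z \<epsilon>) {1..m}"
    and bounded: "\<exists>B. \<forall>\<epsilon>. 0 < \<epsilon> \<longrightarrow> \<epsilon> < \<epsilon>\<^sub>0 \<longrightarrow>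
          (\<forall>j\<in>{1..m}. \<forall>i<d j. AE \<omega> in M \<epsilon>. \<bar>Z \<epsilon> j \<omega> $ i\<bar> \<le> B)"
    and a_dim: "\<And>j. j \<in> {1..m} \<Longrightarrow> a j \<in> carrier_vec (d j)"
    and C_pd: "\<And>j. j \<in> {1..m} \<Longrightarrow> pos_def_mat (d j) (C j)"
    and mean: "\<And>j i. j \<in> {1..m} \<Longrightarrow> i < d j \<Longrightarrow>
          (\<lambda>\<epsilon>. (mean_vec (M \<epsilon>) (d j) (Z \<epsilon> j) - \<epsilon> \<cdot>\<^sub>v a j) $ i) \<in> O[at_right 0](\<lambda>\<epsilon>. \<epsilon> ^ 2)"
    and second_moment: "\<And>j i l. j \<in> {1..m} \<Longrightarrow> i < d j \<Longrightarrow> l < d j \<Longrightarrow>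
          (\<lambda>\<epsilon>. (second_moment_mat (M \<epsilon>) (d j) (Z \<epsilon> j) - C j) $$ (i, l)) \<in> O[at_right 0](\<lambda>\<epsilon>. \<epsilon>)"
    and ind_max: "\<forall>\<^sub>F \<epsilon> in at_right 0. \<forall>j\<in>{1..m}.
          is_ind_maximizer (M \<epsilon>) (d j) (Z \<epsilon> j) (x_ind \<epsilon> j) \<and> (\<forall>i<d j. 0 < x_ind \<epsilon> j $ i)"
    and sim_max: "\<forall>\<^sub>F \<epsilon> in at_right 0.
          is_sim_maximizer (M \<epsilon>) m d (Z \<epsilon>) (x_sim \<epsilon>) \<and>
          (\<forall>j\<in>{1..m}. \<forall>i<d j. 0 < x_sim \<epsilon> j $ i)"
  shows "\<forall>j\<in>{1..m}. 0 \<le> Lambda m C a j \<and>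
    (\<forall>i<d j.
      (\<lambda>\<epsilon>. (x_sim \<epsilon> j - (x_ind \<epsilon> j - (Lambda m C a j * \<epsilon> ^ 3) \<cdot>\<^sub>v alpha C a j)) $ i)
         \<in> O[at_right 0](\<lambda>\<epsilon>. \<epsilon> ^ 4) \<and>
      (\<lambda>\<epsilon>. (x_sim \<epsilon> j - (1 - Lambda m C a j * \<epsilon> ^ 2) \<cdot>\<^sub>v x_ind \<epsilon> j) $ i)
         \<in> O[at_right 0](\<lambda>\<epsilon>. \<epsilon> ^ 4) \<and>
      (\<lambda>\<epsilon>. (x_sim \<epsilon> j - x_ind \<epsilon> j) $ i) \<in> O[at_right 0](\<lambda>\<epsilon>. \<epsilon> ^ 3))"
proof -
  define I where "I = coordinates d {1..m}"
  define W where "W \<epsilon> p \<omega> = entry (\<lambda>j. Z \<epsilon> j \<omega>) p" for \<epsilon> p \<omega>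
  define Q where "Q = block_diagonal C"
  define P where "P = block_diagonal (\<lambda>j. inv_mat (C j))"
  define \<alpha> where "\<alpha> = entry (alpha C a)"
  have small: "\<forall>\<^sub>F \<epsilon> in at_right 0. 0 < \<epsilon> \<and> \<epsilon> < \<epsilon>\<^sub>0"
    using eventually_at_right_real[OF eps0] by simp
  have Iff: "p \<in> I \<longleftrightarrow> fst p \<in> {1..m} \<and> snd p < d (fst p)" for p
    by (simp add: I_def coordinates_iff)
  obtain B\<^sub>0 where B\<^sub>0: "\<And>\<epsilon> j i. 0 < \<epsilon> \<Longrightarrow> \<epsilon> < \<epsilon>\<^sub>0 \<Longrightarrow> j \<in> {1..m} \<Longrightarrow> i < d j \<Longrightarrow>
      AE \<omega> in M \<epsilon>. \<bar>Z \<epsilon> j \<omega> $ i\<bar> \<le> B\<^sub>0"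
    using bounded by blast
  define B where "B = \<bar>B\<^sub>0\<bar> + 1"
  have rv: "Z \<epsilon> j \<in> M \<epsilon> \<rightarrow>\<^sub>M borel_vec (d j)" if "0 < \<epsilon>" "\<epsilon> < \<epsilon>\<^sub>0" "j \<in> {1..m}" for \<epsilon> j
    using indep[OF that(1,2)] that(3) unfolding prob_space.indep_vars_def[OF prob[OF that(1,2)]]
    by blast
  have carrier: "Z \<epsilon> j \<in> space (M \<epsilon>) \<rightarrow> carrier_vec (d j)" if "0 < \<epsilon>" "\<epsilon> < \<epsilon>\<^sub>0" "j \<in> {1..m}" for \<epsilon> j
    using rv[OF that] by (simp add: measurable_borel_vec_iff)
  have W_meas: "W \<epsilon> p \<in> borel_measurable (M \<epsilon>)" if "0 < \<epsilon>" "\<epsilon> < \<epsilon>\<^sub>0" "p \<in> I" for \<epsilon> p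
    using rv[OF that(1,2), of "fst p"] that(3)
    by (auto simp: measurable_borel_vec_iff W_def[abs_def] entry_def Iff)
  have W_bound: "AE \<omega> in M \<epsilon>. \<bar>W \<epsilon> p \<omega>\<bar> \<le> B" if "0 < \<epsilon>" "\<epsilon> < \<epsilon>\<^sub>0" "p \<in> I" for \<epsilon> p
  proof -
    have "AE \<omega> in M \<epsilon>. \<bar>Z \<epsilon> (fst p) \<omega> $ snd p\<bar> \<le> B\<^sub>0"
      using B\<^sub>0[OF that(1,2)] that(3) by (simp add: Iff)
    then show ?thesis
      by eventually_elim (simp add: B_def W_def entry_def)
  qed
  have blocks_indep: "prob_space.indep_var (M \<epsilon>)
      (\<Pi>\<^sub>M p\<in>coordinates d {j}. borel) (\<lambda>\<omega>. \<lambda>p\<in>coordinates d {j}. W \<epsilon> p \<omega>)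
      (\<Pi>\<^sub>M p\<in>I - coordinates d {j}. borel) (\<lambda>\<omega>. \<lambda>p\<in>I - coordinates d {j}. W \<epsilon> p \<omega>)"
    if "0 < \<epsilon>" "\<epsilon> < \<epsilon>\<^sub>0" "j \<in> {1..m}" for \<epsilon> j
    unfolding W_def I_def coordinates_diff
    by (rule prob_space.indep_var_coordinates[OF prob[OF that(1,2)] indep[OF that(1,2)]])
       (use that(3) in auto)
  \<comment> \<open>Different blocks are independent with means \<open>O(\<epsilon>)\<close>, so their mixed moments are \<open>O(\<epsilon>\<^sup>2)\<close> and the limiting second-moment matrix is block diagonal.\<close>
  have cross: "(\<integral>\<omega>. W \<epsilon> p \<omega> * W \<epsilon> q \<omega> \<partial>M \<epsilon>) = (\<integral>\<omega>. W \<epsilon> p \<omega> \<partial>M \<epsilon>) * (\<integral>\<omega>. W \<epsilon> q \<omega> \<partial>M \<epsilon>)"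
    if "0 < \<epsilon>" "\<epsilon> < \<epsilon>\<^sub>0" "p \<in> I" "q \<in> I" "fst p \<noteq> fst q" for \<epsilon> p q
  proof -
    interpret prob_space "M \<epsilon>" using that by (intro prob)
    let ?K = "coordinates d {fst p}"
    have p: "p \<in> ?K" and q: "q \<in> I - ?K"
      using that by (simp_all add: Iff coordinates_iff)
    have j: "fst p \<in> {1..m}" using that(3) by (simp add: Iff)
    have "indep_var borel ((\<lambda>z. z p) \<circ> (\<lambda>\<omega>. \<lambda>p\<in>?K. W \<epsilon> p \<omega>))
        borel ((\<lambda>z. z q) \<circ> (\<lambda>\<omega>. \<lambda>p\<in>I - ?K. W \<epsilon> p \<omega>))"
      by (rule indep_var_compose[OF blocks_indep[OF that(1,2) j]])
         (rule measurable_component_singleton p q)+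
    then have "indep_var borel (W \<epsilon> p) borel (W \<epsilon> q)"
      using p q by (simp add: comp_def)
    then show ?thesis
      by (rule indep_var_lebesgue_integral)
         (auto intro!: integrable_AE_bounded W_meas W_bound that)
  qed
  have W_mean: "(\<lambda>\<epsilon>. (\<integral>\<omega>. W \<epsilon> p \<omega> \<partial>M \<epsilon>) - entry a p * \<epsilon>) \<in> bigO 2" if "p \<in> I" for p
    using mean[of "fst p" "snd p"] that a_dim[of "fst p"]
    by (auto simp: Iff mean_vec_def W_def entry_def mult.commute)
  interpret low_edge M I W B "entry a" \<alpha> Q P
  proof unfold_locales
    show "\<forall>\<^sub>F \<epsilon> in at_right 0. prob_space (M \<epsilon>)"
      using small by eventually_elim (simp add: prob)
    show finI: "finite I" by (simp add: I_def finite_coordinates)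
    show "0 < B" by (simp add: B_def)
    show "0 \<le> (\<Sum>p\<in>I. \<Sum>q\<in>I. y p * Q p q * y q)" for y
    proof -
      have "0 \<le> (\<Sum>j=1..m. \<Sum>i<d j. \<Sum>l<d j. y (j, i) * C j $$ (i, l) * y (j, l))"
        using C_pd by (intro sum_nonneg pos_def_mat_form_nonneg) auto
      also have "\<dots> = (\<Sum>j=1..m. \<Sum>i<d j. y (j, i) * (\<Sum>q\<in>I. Q (j, i) q * y q))"
        unfolding I_def Q_def
        by (intro sum.cong refl) (simp add: sum_block_diagonal sum_distrib_left mult.assoc)
      also have "\<dots> = (\<Sum>p\<in>I. \<Sum>q\<in>I. y p * Q p q * y q)"
        unfolding I_def by (subst sum_coordinates) (simp_all add: sum_distrib_left mult.assoc)
      finally show ?thesis .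
    qed
  next
    fix p assume p: "p \<in> I"
    obtain j i where ji: "p = (j, i)" by (cases p)
    have j: "j \<in> {1..m}" "i < d j" using p by (auto simp: Iff ji)
    show "\<forall>\<^sub>F \<epsilon> in at_right 0. W \<epsilon> p \<in> borel_measurable (M \<epsilon>)"
      using small by eventually_elim (use p in \<open>auto intro: W_meas\<close>)
    show "\<forall>\<^sub>F \<epsilon> in at_right 0. AE \<omega> in M \<epsilon>. \<bar>W \<epsilon> p \<omega>\<bar> \<le> B"
      using small by eventually_elim (use p W_bound in auto)
    show "(\<lambda>\<epsilon>. (\<integral>\<omega>. W \<epsilon> p \<omega> \<partial>M \<epsilon>) - entry a p * \<epsilon>) \<in> bigO 2" by (rule W_mean[OF p])
    show "(\<Sum>q\<in>I. Q p q * \<alpha> q) = entry a p"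
      using pos_def_mat_mult_inverse_vec[OF C_pd[OF j(1)] a_dim[OF j(1)] j(2)] j
      unfolding I_def Q_def ji by (simp add: sum_block_diagonal \<alpha>_def entry_def alpha_def)
    fix q assume q: "q \<in> I"
    obtain k l where kl: "q = (k, l)" by (cases q)
    have k: "k \<in> {1..m}" "l < d k" using q by (auto simp: Iff kl)
    show "Q p q = Q q p"
      using pos_def_mat_sym[OF C_pd[OF j(1)], of i l] j k by (auto simp: Q_def block_diagonal_def ji kl)
    show "(\<Sum>r\<in>I. P p r * Q r q) = (if p = q then 1 else 0)"
      using pos_def_mat_left_inverse_entries[OF C_pd[OF j(1)] j(2), of l] j k
      unfolding I_def P_def ji kl
      by (cases "j = k"; cases "i = l") (simp_all add: sum_block_diagonal, simp_all add: Q_def block_diagonal_def)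
    show "(\<lambda>\<epsilon>. (\<integral>\<omega>. W \<epsilon> p \<omega> * W \<epsilon> q \<omega> \<partial>M \<epsilon>) - Q p q) \<in> bigO 1"
    proof (cases "j = k")
      case True
      have "C j \<in> carrier_mat (d j) (d j)" using C_pd[OF j(1)] by (simp add: pos_def_mat_def)
      then show ?thesis
        using second_moment[OF j, of l] k j True
        by (simp add: ji kl W_def entry_def Q_def block_diagonal_def second_moment_mat_def)
    next
      case False
      have "\<forall>\<^sub>F \<epsilon> in at_right 0. (\<integral>\<omega>. W \<epsilon> p \<omega> * W \<epsilon> q \<omega> \<partial>M \<epsilon>) - Q p q
          = (\<integral>\<omega>. W \<epsilon> p \<omega> \<partial>M \<epsilon>) * (\<integral>\<omega>. W \<epsilon> q \<omega> \<partial>M \<epsilon>)"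
        using small
      proof eventually_elim
        case (elim \<epsilon>)
        have "Q p q = 0" using False by (simp add: Q_def block_diagonal_def ji kl)
        then show ?case using cross[OF _ _ p q, of \<epsilon>] elim False by (simp add: ji kl)
      qed
      moreover have mean_bound: "(\<lambda>\<epsilon>. \<integral>\<omega>. W \<epsilon> r \<omega> \<partial>M \<epsilon>) \<in> bigO 1" if "r \<in> I" for r
        using bigO_add[OF bigO_mono[OF W_mean[OF that], of 1] bigO_monomial[of "entry a r" 1]] by simp
      have "(\<lambda>\<epsilon>. (\<integral>\<omega>. W \<epsilon> p \<omega> \<partial>M \<epsilon>) * (\<integral>\<omega>. W \<epsilon> q \<omega> \<partial>M \<epsilon>)) \<in> bigO 1"
        by (rule bigO_mono[OF bigO_mult[OF mean_bound[OF p] mean_bound[OF q]]]) simp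
      ultimately show ?thesis by (rule bigO_cong)
    qed
  qed
  have sim: "\<forall>\<^sub>F \<epsilon> in at_right 0. interior_optimum (M \<epsilon>) I (W \<epsilon>) (entry (x_sim \<epsilon>))"
    using small sim_max
  proof eventually_elim
    case (elim \<epsilon>)
    show ?case
      unfolding I_def W_def[abs_def]
    proof (rule interior_optimum_coordinates)
      fix y :: "nat \<Rightarrow> real vec" assume "\<And>j. j \<in> {1..m} \<Longrightarrow> y j \<in> stakes (d j)"
      then show "ext_expectation (M \<epsilon>) (\<lambda>\<omega>. ext_ln (1 + (\<Sum>j=1..m. y j \<bullet> Z \<epsilon> j \<omega>)))
          \<le> ext_expectation (M \<epsilon>) (\<lambda>\<omega>. ext_ln (1 + (\<Sum>j=1..m. x_sim \<epsilon> j \<bullet> Z \<epsilon> j \<omega>)))"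
        using elim(2)
        unfolding is_sim_maximizer_def is_arg_max_def growth_sing_def not_less[symmetric] by blast
    qed (use elim carrier in auto)
  qed
  show ?thesis
  proof (intro ballI conjI allI impI)
    fix j assume j: "j \<in> {1..m}"
    show "0 \<le> Lambda m C a j" by (rule Lambda_nonneg[OF a_dim C_pd])
    fix i assume i: "i < d j"
    have ind: "\<forall>\<^sub>F \<epsilon> in at_right 0.
        interior_optimum (M \<epsilon>) (coordinates d {j}) (W \<epsilon>) (entry (x_ind \<epsilon>))"
      using small ind_max
    proof eventually_elim
      case (elim \<epsilon>)
      show ?case
        unfolding W_def[abs_def]
      proof (rule interior_optimum_coordinates)
        fix y :: "nat \<Rightarrow> real vec" assume "\<And>k. k \<in> {j} \<Longrightarrow> y k \<in> stakes (d k)"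
        then show "ext_expectation (M \<epsilon>) (\<lambda>\<omega>. ext_ln (1 + (\<Sum>k\<in>{j}. y k \<bullet> Z \<epsilon> k \<omega>)))
            \<le> ext_expectation (M \<epsilon>) (\<lambda>\<omega>. ext_ln (1 + (\<Sum>k\<in>{j}. x_ind \<epsilon> k \<bullet> Z \<epsilon> k \<omega>)))"
          using elim(2) j by (auto simp: is_ind_maximizer_def is_arg_max_def growth_ind_def not_less)
      qed (use elim j carrier in auto)
    qed
    interpret block_interaction M I W B "entry a" \<alpha> Q P "coordinates d {j}"
      "\<lambda>\<epsilon>. entry (x_sim \<epsilon>)" "\<lambda>\<epsilon>. entry (x_ind \<epsilon>)"
    proof unfold_locales
      show "coordinates d {j} \<subseteq> I" using j by (auto simp: coordinates_def I_def)
      show "Q p q = 0" if "p \<in> coordinates d {j}" "q \<in> I - coordinates d {j}" for p q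
        using that by (auto simp: coordinates_def I_def Q_def block_diagonal_def)
      show "\<forall>\<^sub>F \<epsilon> in at_right 0. prob_space.indep_var (M \<epsilon>)
          (\<Pi>\<^sub>M p\<in>coordinates d {j}. borel) (\<lambda>\<omega>. \<lambda>p\<in>coordinates d {j}. W \<epsilon> p \<omega>)
          (\<Pi>\<^sub>M p\<in>I - coordinates d {j}. borel) (\<lambda>\<omega>. \<lambda>p\<in>I - coordinates d {j}. W \<epsilon> p \<omega>)"
        using small by eventually_elim (use j in \<open>auto intro: blocks_indep\<close>)
    qed (rule sim ind)+
    have L: "\<Lambda> = Lambda m C a j"
      unfolding \<Lambda>_def unfolding \<alpha>_def I_def coordinates_diff
      using Lambda_coordinates[of m a d C j] a_dim C_pd by simp
    have ji: "(j, i) \<in> coordinates d {j}" using i by (simp add: coordinates_iff)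
    have dim_alpha: "dim_vec (alpha C a j) = d j"
      using pos_def_mat_inverse(1)[OF C_pd[OF j]] by (simp add: alpha_def)
    have dim_ind: "\<forall>\<^sub>F \<epsilon> in at_right 0. dim_vec (x_ind \<epsilon> j) = d j"
      using ind_max by eventually_elim
        (use j in \<open>auto simp: is_ind_maximizer_def is_arg_max_def stakes_def\<close>)
    have cubic: "(\<lambda>\<epsilon>. x_sim \<epsilon> j $ i - x_ind \<epsilon> j $ i + Lambda m C a j * alpha C a j $ i * \<epsilon> ^ 3) \<in> bigO 4"
      using cubic_shrinkage[OF ji] unfolding L by (simp add: \<alpha>_def entry_def)
    have first: "(\<lambda>\<epsilon>. x_ind \<epsilon> j $ i - alpha C a j $ i * \<epsilon>) \<in> bigO 2"
      using K.optimum_first_approx[OF ind ji] by (simp add: \<alpha>_def entry_def)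
    show "(\<lambda>\<epsilon>. (x_sim \<epsilon> j - (x_ind \<epsilon> j - (Lambda m C a j * \<epsilon> ^ 3) \<cdot>\<^sub>v alpha C a j)) $ i)
        \<in> O[at_right 0](\<lambda>\<epsilon>. \<epsilon> ^ 4)"
      using cubic i dim_alpha by (simp add: algebra_simps)
    \<comment> \<open>Replacing \<open>\<epsilon> \<alpha>\<close> by the isolated stakes in the correction costs \<open>\<epsilon>\<^sup>2\<close> times an error \<open>O(\<epsilon>\<^sup>2)\<close>.\<close>
    have "(\<lambda>\<epsilon>. Lambda m C a j * \<epsilon> ^ 2 * (x_ind \<epsilon> j $ i - alpha C a j $ i * \<epsilon>)) \<in> bigO (2 + 2)"
      by (rule bigO_mult[OF bigO_monomial first])
    then have "(\<lambda>\<epsilon>. Lambda m C a j * \<epsilon> ^ 2 * (x_ind \<epsilon> j $ i - alpha C a j $ i * \<epsilon>)) \<in> bigO 4"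
      by simp
    from bigO_add[OF cubic this]
    have scaled: "(\<lambda>\<epsilon>. x_sim \<epsilon> j $ i - (1 - Lambda m C a j * \<epsilon> ^ 2) * x_ind \<epsilon> j $ i) \<in> bigO 4"
      by (simp add: algebra_simps power2_eq_square power3_eq_cube)
    show "(\<lambda>\<epsilon>. (x_sim \<epsilon> j - (1 - Lambda m C a j * \<epsilon> ^ 2) \<cdot>\<^sub>v x_ind \<epsilon> j) $ i)
        \<in> O[at_right 0](\<lambda>\<epsilon>. \<epsilon> ^ 4)"
      by (rule bigO_cong[OF _ scaled], rule eventually_mono[OF dim_ind]) (use i in simp)
    have diff: "(\<lambda>\<epsilon>. x_sim \<epsilon> j $ i - x_ind \<epsilon> j $ i) \<in> bigO 3"
      using stake_difference_bigO[OF ji] by (simp add: entry_def)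
    show "(\<lambda>\<epsilon>. (x_sim \<epsilon> j - x_ind \<epsilon> j) $ i) \<in> O[at_right 0](\<lambda>\<epsilon>. \<epsilon> ^ 3)"
      by (rule bigO_cong[OF _ diff], rule eventually_mono[OF dim_ind]) (use i in simp)
  qed
qed

end
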